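(* There exist absolute constants $C,c,c'>0$ such that, setting $\varepsilon_0 = c^2/c'$, $\zeta_1(\delta) = C\sqrt{\delta}$ and $\zeta_2(\delta) = 1/\sqrt{c-\sqrt{c'\delta}}$, the following holds. Let $d\geq1$, $L\geq 2$, $p\in[1,\infty]$, $p'\in[1,\infty]$ with $\frac1p+\frac1{p'}=1$. Let $f:\mathbb{R}^d\to\mathbb{R}^L$ be a linear $L$-class classifier, $f_l(\boldsymbol{z}) = \boldsymbol{w}_l^T\boldsymbol{z}+\boldsymbol{b}_l$ for $l=1,\dots,L$, with predicted label $g(\boldsymbol{z}) = \operatorname{argmax}_l f_l(\boldsymbol{z})$. Let $\boldsymbol{x}\in\mathbb{R}^d$, $k = g(\boldsymbol{x})$, assume $\boldsymbol{w}_l\neq\boldsymbol{w}_k$ for all $l\neq k$ and $\|\boldsymbol{r}^*_p(\boldsymbol{x})\|_p>0$. Let $j$ be a class such that $\boldsymbol{x}+\boldsymbol{r}^*_p(\boldsymbol{x})$ lies on the decision boundary between classes $k$ and $j$, and let $j' \in \operatorname{argmin}_{l\neq k}\frac{\|\boldsymbol{w}_k-\boldsymbol{w}_l\|_{p'}}{\|\boldsymbol{w}_k-\boldsymbol{w}_l\|_2}$. Then for every $0<\varepsilon<\varepsilon_0$, \[ \zeta_1\!\left(\frac{\varepsilon}{L-1}\right) d^{1/p}\frac{\|\boldsymbol{w}_k-\boldsymbol{w}_{j'}\|_{p'}}{\|\boldsymbol{w}_k-\boldsymbol{w}_{j'}\|_2} \leq \frac{r_{p,\varepsilon}(\boldsymbol{x})}{\|\boldsymbol{r}^*_p(\boldsymbol{x})\|_p}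 \leq \zeta_2(\varepsilon)\, d^{1/p}\frac{\|\boldsymbol{w}_k-\boldsymbol{w}_j\|_{p'}}{\|\boldsymbol{w}_k-\boldsymbol{w}_j\|_2}. \]
   Context: $\mathcal{B}_p = \{\boldsymbol{z}\in\mathbb{R}^d : \|\boldsymbol{z}\|_p\leq1\}$ and $\boldsymbol{v}$ is uniformly distributed on $\mathcal{B}_p$. $r_{p,\varepsilon}(\boldsymbol{x}) = \inf\{|\alpha| : \alpha\in\mathbb{R},\ \mathbb{P}_{\boldsymbol{v}}\{g(\boldsymbol{x}+\alpha\boldsymbol{v})\neq g(\boldsymbol{x})\}\geq\varepsilon\}$ ($\inf\emptyset=+\infty$). $\boldsymbol{r}^*_p(\boldsymbol{x})$ is a minimizer of $\|\boldsymbol{r}\|_p$ subject to $g(\boldsymbol{x}+\boldsymbol{r})\neq g(\boldsymbol{x})$ (minimal $\ell_p$ perturbation changing the label). Here $d^{1/\infty}=1$. *)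

theory Defs
  imports "HOL-Probability.Probability"
begin

text \<open>Vectors of R^d are represented as functions nat => real; only the
coordinates i < d matter. The exponent p ranges over [1, infinity] as an ereal.\<close>

definition lp_norm :: "ereal \<Rightarrow> nat \<Rightarrow> (nat \<Rightarrow> real) \<Rightarrow> real" where
  "lp_norm p d z = (if p = \<infinity> then Max ({0} \<union> (\<lambda>i. \<bar>z i\<bar>) ` {..<d})
     else (\<Sum>i<d. \<bar>z i\<bar> powr real_of_ereal p) powr (1 / real_of_ereal p))"

definition d_pow :: "ereal \<Rightarrow> nat \<Rightarrow> real" where
  "d_pow p d = (if p = \<infinity> then 1 else real d powr (1 / real_of_ereal p))"

definition lin_f :: "(nat \<Rightarrow> nat \<Rightarrow> real) \<Rightarrow> (nat \<Rightarrow> real) \<Rightarrow> nat \<Rightarrow> nat \<Rightarrow> (nat \<Rightarrow> real) \<Rightarrow> real" where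
  "lin_f W b d l z = (\<Sum>i<d. W l i * z i) + b l"

definition label_set :: "(nat \<Rightarrow> nat \<Rightarrow> real) \<Rightarrow> (nat \<Rightarrow> real) \<Rightarrow> nat \<Rightarrow> nat \<Rightarrow> (nat \<Rightarrow> real) \<Rightarrow> nat set" where
  "label_set W b L d z = {l. l < L \<and> (\<forall>m<L. lin_f W b d m z \<le> lin_f W b d l z)}"

definition Rd :: "nat \<Rightarrow> (nat \<Rightarrow> real) measure" where
  "Rd d = PiM {..<d} (\<lambda>_. lborel)"

definition lp_ball :: "ereal \<Rightarrow> nat \<Rightarrow> (nat \<Rightarrow> real) set" where
  "lp_ball p d = {v \<in> space (Rd d). lp_norm p d v \<le> 1}"

definition flip_prob :: "(nat \<Rightarrow> nat \<Rightarrow> real) \<Rightarrow> (nat \<Rightarrow> real) \<Rightarrow> nat \<Rightarrow> nat \<Rightarrow> ereal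
    \<Rightarrow> (nat \<Rightarrow> real) \<Rightarrow> real \<Rightarrow> real" where
  "flip_prob W b L d p x \<alpha> = measure (uniform_measure (Rd d) (lp_ball p d))
     {v \<in> space (Rd d). label_set W b L d (\<lambda>i. x i + \<alpha> * v i) \<noteq> label_set W b L d x}"

text \<open>r_{p,eps}(x) = inf { |alpha| : P >= eps }, inf of the empty set = +infinity.\<close>
definition r_eps :: "(nat \<Rightarrow> nat \<Rightarrow> real) \<Rightarrow> (nat \<Rightarrow> real) \<Rightarrow> nat \<Rightarrow> nat \<Rightarrow> ereal
    \<Rightarrow> (nat \<Rightarrow> real) \<Rightarrow> real \<Rightarrow> ereal" where
  "r_eps W b L d p x \<epsilon> = Inf {ereal \<bar>\<alpha>\<bar> | \<alpha>. flip_prob W b L d p x \<alpha> \<ge> \<epsilon>}"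

definition is_min_pert :: "(nat \<Rightarrow> nat \<Rightarrow> real) \<Rightarrow> (nat \<Rightarrow> real) \<Rightarrow> nat \<Rightarrow> nat \<Rightarrow> ereal
    \<Rightarrow> (nat \<Rightarrow> real) \<Rightarrow> (nat \<Rightarrow> real) \<Rightarrow> bool" where
  "is_min_pert W b L d p x r \<longleftrightarrow>
     label_set W b L d (\<lambda>i. x i + r i) \<noteq> label_set W b L d x \<and>
     (\<forall>r'. label_set W b L d (\<lambda>i. x i + r' i) \<noteq> label_set W b L d x \<longrightarrow> lp_norm p d r \<le> lp_norm p d r')"

definition w_ratio :: "(nat \<Rightarrow> nat \<Rightarrow> real) \<Rightarrow> nat \<Rightarrow> ereal \<Rightarrow> nat \<Rightarrow> nat \<Rightarrow> real" where
  "w_ratio W d q k l = lp_norm q d (\<lambda>i. W k i - W l i) / lp_norm 2 d (\<lambda>i. W k i - W l i)"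

end

theory Submission
  imports Defs
begin

text \<open>
With the weights \<open>w\<^sub>l = W\<^sub>l - W\<^sub>k\<close> and the positive gaps \<open>f\<^sub>k(x) - f\<^sub>l(x)\<close>, a perturbation \<open>y\<close> changes the
label iff \<open>\<langle>w\<^sub>l, y\<rangle>\<close> reaches the gap of some class \<open>l\<close>. By Hoelder's inequality and its equality case, the
minimal perturbation has norm at most \<open>gap\<^sub>l\<close> divided by the dual norm of \<open>w\<^sub>l\<close>, with equality for \<open>l = j\<close>.
The lower bound is then a union bound with Chebyshev's inequality, and the upper bound is the
Paley--Zygmund inequality for \<open>\<langle>w\<^sub>j, v\<rangle>\<^sup>2\<close>. Both need only that, for \<open>v\<close> uniform on the ball and
\<open>D = d\<^sup>1\<^sup>/\<^sup>p\<close>, the second moments of the coordinates are of exact order \<open>D\<^sup>-\<^sup>2\<close> and the fourth ones are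
\<open>O(D\<^sup>-\<^sup>4)\<close>, uniformly in \<open>p\<close> and \<open>d\<close>; reflection symmetry transfers this to linear forms. No Gamma
function is needed: for \<open>p < \<infinity>\<close>, scaling of Lebesgue measure gives the volume of the slice \<open>v\<^sub>i = y\<close>
as \<open>(1 - |y|\<^sup>p)\<^bsup>(d-1)/p\<^esup>\<close> times that of the central slice. This factor is at least \<open>1/e\<close> for
\<open>|y| \<le> 1/(2D)\<close> and at most \<open>exp(3/2 - D|y|/2)\<close> for \<open>|y| \<le> 1\<close>.
\<close>

subsection \<open>The norms and Hoelder's inequality\<close>

lemma ereal_ge_1_cases:
  fixes p :: ereal
  assumes "p \<ge> 1"
  obtains "p = \<infinity>" | a where "p = ereal a" "a \<ge> 1"
  using assms by (cases p) auto

lemma lp_norm_infty_le_iff: "0 \<le> t \<Longrightarrow> lp_norm \<infinity> d z \<le> t \<longleftrightarrow> (\<forall>i<d. \<bar>z i\<bar> \<le> t)"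
  by (auto simp: lp_norm_def)

text \<open>The outer root does not affect comparison with 1, so the unit ball is described by the
  power sum alone.\<close>

lemma lp_norm_ereal_le_1_iff:
  assumes "a \<ge> 1"
  shows "lp_norm (ereal a) d z \<le> 1 \<longleftrightarrow> (\<Sum>i<d. \<bar>z i\<bar> powr a) \<le> 1"
proof -
  have "0 \<le> (\<Sum>i<d. \<bar>z i\<bar> powr a)" by (simp add: sum_nonneg)
  then show ?thesis
    using assms powr_mono2[of "1 / a" "\<Sum>i<d. \<bar>z i\<bar> powr a" 1]
      powr_mono2[of a "(\<Sum>i<d. \<bar>z i\<bar> powr a) powr (1 / a)" 1]
    by (auto simp: lp_norm_def powr_powr)
qed

lemma lp_norm_nonneg: "0 \<le> lp_norm p d z"
  by (auto simp: lp_norm_def)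

lemma lp_norm_2: "lp_norm 2 d z = sqrt (\<Sum>i<d. (z i)\<^sup>2)"
proof -
  have "(2 :: ereal) \<noteq> \<infinity>" by simp
  then show ?thesis
  by (simp add: lp_norm_def powr_half_sqrt sum_nonneg)
qed

lemma lp_norm_le_1_coord:
  assumes "p \<ge> 1" "lp_norm p d z \<le> 1" "i < d"
  shows "\<bar>z i\<bar> \<le> 1"
proof (cases rule: ereal_ge_1_cases[OF assms(1)])
  case 1
  then show ?thesis using assms by (simp add: lp_norm_infty_le_iff)
next
  case (2 a)
  have "\<bar>z i\<bar> powr a \<le> (\<Sum>i<d. \<bar>z i\<bar> powr a)"
    using assms(3) by (intro member_le_sum) auto
  also have "\<dots> \<le> 1" using assms(2) 2 lp_norm_ereal_le_1_iff by simp
  finally show ?thesis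
    using powr_mono2[of "1/a" "\<bar>z i\<bar> powr a" 1] 2 by (simp add: powr_powr)
qed

lemma pos_d_pow: "d \<ge> 1 \<Longrightarrow> 0 < d_pow p d"
  by (simp add: d_pow_def)

lemma lp_norm_eq_0:
  assumes "p \<ge> 1" "lp_norm p d z = 0" "i < d"
  shows "z i = 0"
proof (cases rule: ereal_ge_1_cases[OF assms(1)])
  case 1
  then show ?thesis using assms lp_norm_infty_le_iff[of 0 d z] by auto
next
  case (2 a)
  then have "(\<Sum>i<d. \<bar>z i\<bar> powr a) = 0"
    using assms(2) by (simp add: lp_norm_def)
  then show ?thesis using assms(3) by (simp add: sum_nonneg_eq_0_iff)
qed

text \<open>If both exponents are finite, neither is 1, because the reciprocal of the other would
  have to vanish; hence 1 pairs only with infinity.\<close>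

lemma conjugate_exponent_cases:
  fixes p q :: ereal
  assumes "p \<ge> 1" "q \<ge> 1" "inverse p + inverse q = 1"
  obtains "p = \<infinity>" "q = 1" | "p = 1" "q = \<infinity>"
  | a b where "p = ereal a" "q = ereal b" "a > 1" "b > 1" "1 / a + 1 / b = 1"
proof (cases rule: ereal_ge_1_cases[OF assms(1)])
  case 1
  then have "inverse q = 1" using assms by simp
  then have "q = 1" using assms(2) by (cases q) (auto simp: one_ereal_def)
  then show ?thesis using that 1 by blast
next
  case (2 a)
  show ?thesis
  proof (cases rule: ereal_ge_1_cases[OF assms(2)])
    case 1
    then have "p = 1" using assms 2 by (auto simp: one_ereal_def)
    then show ?thesis using that 1 by blast
  next
    case (2 b)
    have "1 / a + 1 / b = 1" using assms(3) 2 \<open>p = ereal a\<close> \<open>a \<ge> 1\<close> by (simp add: one_ereal_def divide_inverse)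
    moreover from this have "a \<noteq> 1" "b \<noteq> 1" using \<open>a \<ge> 1\<close> \<open>b \<ge> 1\<close> by auto
    ultimately show ?thesis using that(3)[of a b] 2 \<open>p = ereal a\<close> \<open>a \<ge> 1\<close> by auto
  qed
qed

lemma lp_norm_1: "lp_norm 1 d z = (\<Sum>i<d. \<bar>z i\<bar>)"
  by (simp add: lp_norm_def sum_nonneg)

lemma lp_norm_ereal_powr: "a \<ge> 1 \<Longrightarrow> lp_norm (ereal a) d z powr a = (\<Sum>i<d. \<bar>z i\<bar> powr a)"
  by (simp add: lp_norm_def powr_powr sum_nonneg)

text \<open>This serves both endpoint pairs of exponents, with the roles of \<open>w\<close> and
  \<open>z\<close> exchanged in the second.\<close>

lemma Holder_infty: "(\<Sum>i<d. w i * z i) \<le> (\<Sum>i<d. \<bar>w i\<bar>) * lp_norm \<infinity> d z"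
proof -
  have "w i * z i \<le> \<bar>w i\<bar> * lp_norm \<infinity> d z" if "i < d" for i
  proof -
    have "w i * z i \<le> \<bar>w i\<bar> * \<bar>z i\<bar>" by (metis abs_ge_self abs_mult)
    also have "\<dots> \<le> \<bar>w i\<bar> * lp_norm \<infinity> d z"
      using that lp_norm_infty_le_iff[of "lp_norm \<infinity> d z" d z] by (intro mult_left_mono) (auto simp: lp_norm_nonneg)
    finally show ?thesis .
  qed
  then show ?thesis
    unfolding sum_distrib_right by (intro sum_mono) simp
qed

text \<open>For finite exponents both vectors are normalised and Young's inequality is applied to
  each product; the bounds sum up to \<open>1 / a + 1 / b = 1\<close>.\<close>

lemma Holder_inequality:
  assumes "p \<ge> 1" "q \<ge> 1" "inverse p + inverse q = 1"
  shows "(\<Sum>i<d. w i * z i) \<le> lp_norm q d w * lp_norm p d z"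
proof (cases rule: conjugate_exponent_cases[OF assms])
  case 1
  then show ?thesis by (simp add: Holder_infty lp_norm_1)
next
  case 2
  then show ?thesis using Holder_infty[of z w d] by (simp add: lp_norm_1 mult.commute)
next
  case (3 a b)
  define A where "A = lp_norm p d z"
  define B where "B = lp_norm q d w"
  show ?thesis
  \<comment> \<open>Normalising needs nonzero norms; a zero norm makes every product vanish.\<close>
  proof (cases "A = 0 \<or> B = 0")
    case True
    then have "(\<Sum>i<d. w i * z i) = 0"
      using lp_norm_eq_0[of p d z] lp_norm_eq_0[of q d w] assms by (auto simp: A_def B_def intro!: sum.neutral)
    then show ?thesis by (simp add: lp_norm_nonneg)
  next
    case False
    then have pos: "A > 0" "B > 0" using lp_norm_nonneg[of p d z] lp_norm_nonneg[of q d w] by (auto simp: A_def B_def)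
    have "(\<Sum>i<d. w i * z i) / (A * B) \<le> (\<Sum>i<d. (\<bar>z i\<bar> / A) powr a / a + (\<bar>w i\<bar> / B) powr b / b)"
      unfolding sum_divide_distrib
    proof (rule sum_mono)
      fix i
      have "w i * z i / (A * B) \<le> \<bar>w i\<bar> * \<bar>z i\<bar> / (A * B)"
        using pos by (intro divide_right_mono) (metis abs_ge_self abs_mult, simp)
      also have "\<dots> = (\<bar>z i\<bar> / A) * (\<bar>w i\<bar> / B)" by simp
      also have "\<dots> \<le> (\<bar>z i\<bar> / A) powr a / a + (\<bar>w i\<bar> / B) powr b / b"
        using 3 pos by (intro Youngs_inequality) auto
      finally show "w i * z i / (A * B) \<le> (\<bar>z i\<bar> / A) powr a / a + (\<bar>w i\<bar> / B) powr b / b" .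
    qed
    also have "\<dots> = (\<Sum>i<d. \<bar>z i\<bar> powr a) / A powr a / a + (\<Sum>i<d. \<bar>w i\<bar> powr b) / B powr b / b"
      using pos by (simp add: sum.distrib powr_divide sum_divide_distrib)
    also have "\<dots> = 1"
      using pos 3 by (simp add: A_def B_def flip: lp_norm_ereal_powr)
    finally show ?thesis using pos by (simp add: field_simps A_def B_def)
  qed
qed

text \<open>This is the equality case of Hoelder's inequality. The vector has the signs of
  \<open>w\<close> and constant modulus for \<open>p = \<infinity>\<close>, lives on one coordinate
  where \<open>w\<close> has maximal modulus for \<open>p = 1\<close>, and has modulus proportional
  to \<open>\<bar>w i\<bar> powr (b - 1)\<close> otherwise.\<close>

lemma lp_norm_dual_vector:
  assumes "p \<ge> 1" "q \<ge> 1" "inverse p + inverse q = 1" and w: "\<exists>i<d. w i \<noteq> 0" and t: "t \<ge> 0"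
  obtains z where "(\<Sum>i<d. w i * z i) = t" "lp_norm p d z \<le> t / lp_norm q d w"
proof -
  have pos: "lp_norm q d w > 0"
    using w lp_norm_eq_0[of q d w] assms(2) lp_norm_nonneg[of q d w] by fastforce
  show ?thesis
  proof (cases rule: conjugate_exponent_cases[OF assms(1-3)])
    case 1
    define N where "N = (\<Sum>i<d. \<bar>w i\<bar>)"
    have N: "N > 0" using pos 1 by (simp add: lp_norm_1 N_def)
    show ?thesis
    proof (rule that[of "\<lambda>i. sgn (w i) * t / N"])
      have "(\<Sum>i<d. w i * (sgn (w i) * t / N)) = (\<Sum>i<d. \<bar>w i\<bar>) * t / N"
        by (simp add: abs_sgn sum_distrib_right sum_divide_distrib mult.assoc)
      then show "(\<Sum>i<d. w i * (sgn (w i) * t / N)) = t"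
        using N by (simp add: N_def)
      show "lp_norm p d (\<lambda>i. sgn (w i) * t / N) \<le> t / lp_norm q d w"
        using N t 1 by (auto simp: lp_norm_1 N_def[symmetric] lp_norm_infty_le_iff abs_mult abs_sgn_eq)
    qed
  next
    case 2
    define N where "N = lp_norm q d w"
    \<comment> \<open>The maximum is taken over a set with 0 adjoined; since the norm is positive, a
      coordinate attains it.\<close>
    have "N \<in> {0} \<union> (\<lambda>i. \<bar>w i\<bar>) ` {..<d}"
      unfolding N_def lp_norm_def using 2 by (simp only: if_True simp_thms) (rule Max_in, auto)
    then obtain m where m: "m < d" "\<bar>w m\<bar> = N" using pos N_def by auto
    show ?thesis
    proof (rule that[of "\<lambda>i. if i = m then sgn (w m) * t / N else 0"])
      have "(\<Sum>i<d. w i * (if i = m then sgn (w m) * t / N else 0)) = w m * (sgn (w m) * t / N)"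
        using m by (subst sum.remove[of _ m]) auto
      also have "\<dots> = \<bar>w m\<bar> * t / N" by (simp add: abs_sgn mult.assoc)
      finally show "(\<Sum>i<d. w i * (if i = m then sgn (w m) * t / N else 0)) = t"
        using m pos by (simp add: N_def)
      have "lp_norm p d (\<lambda>i. if i = m then sgn (w m) * t / N else 0) = \<bar>sgn (w m) * t / N\<bar>"
        using m 2 by (simp add: lp_norm_1 if_distrib[of abs] sum.delta del: abs_divide cong: if_cong)
      also have "\<dots> \<le> t / N" using t pos by (simp add: abs_mult abs_sgn_eq N_def)
      finally show "lp_norm p d (\<lambda>i. if i = m then sgn (w m) * t / N else 0) \<le> t / lp_norm q d w"
        by (simp add: N_def)
    qed
  next
    case (3 a b)
    define N where "N = lp_norm q d w"
    have N: "N > 0" using pos N_def by simp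
    have Nb: "N powr b = (\<Sum>i<d. \<bar>w i\<bar> powr b)" using lp_norm_ereal_powr[of b d w] 3 by (simp add: N_def)
    \<comment> \<open>In this form conjugacy makes \<open>\<bar>z i\<bar> powr a\<close>
      proportional to \<open>\<bar>w i\<bar> powr b\<close>.\<close>
    have ab: "a * (b - 1) = b" using 3 by (simp add: field_simps)
    define z where "z = (\<lambda>i. sgn (w i) * \<bar>w i\<bar> powr (b - 1) * t / N powr b)"
    show ?thesis
    proof (rule that[of z])
      have wz: "w i * z i = \<bar>w i\<bar> powr b * t / N powr b" for i
        by (cases "w i = 0") (auto simp: z_def sgn_if powr_diff)
      show "(\<Sum>i<d. w i * z i) = t"
        unfolding wz using N by (simp add: Nb[symmetric] flip: sum_divide_distrib sum_distrib_right)
      have zp: "\<bar>z i\<bar> powr a = \<bar>w i\<bar> powr b * (t / N powr b) powr a" for i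
      proof -
        have "\<bar>z i\<bar> = \<bar>w i\<bar> powr (b - 1) * (t / N powr b)"
          using t by (simp add: z_def abs_mult abs_sgn_eq)
        then have "\<bar>z i\<bar> powr a = (\<bar>w i\<bar> powr (b - 1)) powr a * (t / N powr b) powr a"
          using t by (simp only: powr_mult powr_ge_zero divide_nonneg_nonneg)
        then show ?thesis using ab by (simp add: powr_powr mult.commute)
      qed
      have "lp_norm p d z = (N powr b * (t / N powr b) powr a) powr (1 / a)"
        using 3 by (simp add: lp_norm_def zp Nb[symmetric] flip: sum_distrib_right)
      also have "\<dots> = N powr (b / a) * (t / N powr b)"
        using 3 N t by (simp add: powr_mult powr_powr)
      also have "\<dots> = t / N powr (b - b / a)"
        using N by (simp add: powr_diff)
      also have "b - b / a = 1" using 3 by (simp add: field_simps)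
      finally show "lp_norm p d z \<le> t / lp_norm q d w" using N by (simp add: N_def)
    qed
  qed
qed

subsection \<open>Slices of the unit ball\<close>

lemma emeasure_lborel_mult_vimage:
  fixes c :: real
  assumes "c \<noteq> 0" "X \<in> sets borel"
  shows "ennreal \<bar>c\<bar> * emeasure lborel ((\<lambda>x. c * x) -` X) = emeasure lborel X"
proof -
  have "emeasure lborel X = emeasure (density (distr lborel borel ((*) c)) (\<lambda>_. \<bar>c\<bar>)) X"
    using lborel_distr_mult'[OF assms(1)] by simp
  also have "\<dots> = ennreal \<bar>c\<bar> * emeasure lborel ((\<lambda>x. c * x) -` X)"
    using assms(2) by (subst emeasure_density_const) (simp_all add: emeasure_distr)
  finally show ?thesis by simp
qed

text \<open>Both sides agree on boxes by the one-dimensional rule in each factor, and boxes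
  determine the product measure. A separate factor per coordinate covers dilations as well as
  reflections.\<close>

lemma PiM_lborel_mult:
  fixes c :: "'i \<Rightarrow> real"
  assumes fin: "finite I" and c: "\<And>i. i \<in> I \<Longrightarrow> c i \<noteq> 0"
  shows "Pi\<^sub>M I (\<lambda>_. lborel) = scale_measure (\<Prod>i\<in>I. ennreal \<bar>c i\<bar>)
    (distr (Pi\<^sub>M I (\<lambda>_. lborel)) (Pi\<^sub>M I (\<lambda>_. lborel)) (\<lambda>v. \<lambda>i\<in>I. c i * v i))"
proof -
  interpret product_sigma_finite "\<lambda>_::'i. lborel :: real measure" by standard
  have meas: "(\<lambda>v. \<lambda>i\<in>I. c i * v i) \<in> measurable (Pi\<^sub>M I (\<lambda>_. lborel)) (Pi\<^sub>M I (\<lambda>_. lborel))"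
    by measurable
  show ?thesis
  proof (rule PiM_eqI[symmetric])
    fix A :: "'i \<Rightarrow> real set" assume A: "\<And>i. i \<in> I \<Longrightarrow> A i \<in> sets lborel"
    have "(\<lambda>v. \<lambda>i\<in>I. c i * v i) -` Pi\<^sub>E I A \<inter> space (Pi\<^sub>M I (\<lambda>_. lborel))
        = Pi\<^sub>E I (\<lambda>i. (\<lambda>x. c i * x) -` A i)"
      by (auto simp: space_PiM PiE_iff)
    moreover have "(\<lambda>x. c i * x) -` A i \<in> sets lborel" if "i \<in> I" for i
      using measurable_sets_borel[of "\<lambda>x. c i * x" borel "A i"] A[OF that] by simp
    ultimately have "emeasure (distr (Pi\<^sub>M I (\<lambda>_. lborel)) (Pi\<^sub>M I (\<lambda>_. lborel)) (\<lambda>v. \<lambda>i\<in>I. c i * v i)) (Pi\<^sub>E I A)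
        = (\<Prod>i\<in>I. emeasure lborel ((\<lambda>x. c i * x) -` A i))"
      using A fin by (subst emeasure_distr[OF meas]) (auto intro!: sets_PiM_I_finite emeasure_PiM)
    then show "emeasure (scale_measure (\<Prod>i\<in>I. ennreal \<bar>c i\<bar>)
        (distr (Pi\<^sub>M I (\<lambda>_. lborel)) (Pi\<^sub>M I (\<lambda>_. lborel)) (\<lambda>v. \<lambda>i\<in>I. c i * v i))) (Pi\<^sub>E I A)
        = (\<Prod>i\<in>I. emeasure lborel (A i))"
      using A c by (auto simp: prod.distrib[symmetric] emeasure_lborel_mult_vimage intro!: prod.cong)
  qed (use fin in auto)
qed

text \<open>Dilation by \<open>u\<close> pulls the ball of radius \<open>u\<close> back to the unit
  ball, and each coordinate contributes one factor \<open>u\<close>.\<close>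

lemma emeasure_powr_ball_scale:
  fixes u p :: real
  assumes fin: "finite J" and u: "u > 0"
  shows "emeasure (Pi\<^sub>M J (\<lambda>_. lborel)) {v \<in> space (Pi\<^sub>M J (\<lambda>_. lborel)). (\<Sum>i\<in>J. \<bar>v i\<bar> powr p) \<le> u powr p}
    = ennreal (u ^ card J) *
      emeasure (Pi\<^sub>M J (\<lambda>_. lborel)) {v \<in> space (Pi\<^sub>M J (\<lambda>_. lborel)). (\<Sum>i\<in>J. \<bar>v i\<bar> powr p) \<le> 1}"
    (is "emeasure ?M ?X = _ * emeasure ?M ?Y")
proof -
  let ?f = "\<lambda>v. \<lambda>i\<in>J. u * v i"
  have "(\<Sum>i\<in>J. \<bar>u * v i\<bar> powr p) = u powr p * (\<Sum>i\<in>J. \<bar>v i\<bar> powr p)" for v :: "'a \<Rightarrow> real"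
    using u by (simp add: abs_mult powr_mult sum_distrib_left)
  then have "?f -` ?X \<inter> space ?M = ?Y"
    using u by (auto simp: space_PiM)
  moreover have "emeasure ?M ?X = ennreal (u ^ card J) * emeasure (distr ?M ?M ?f) ?X"
    using u by (subst PiM_lborel_mult[OF fin, of "\<lambda>_. u"]) (auto simp: ennreal_power)
  moreover have "emeasure (distr ?M ?M ?f) ?X = emeasure ?M (?f -` ?X \<inter> space ?M)"
    using u by (intro emeasure_distr) measurable
  ultimately show ?thesis by simp
qed

section \<open>One-dimensional moments under exponential decay\<close>

lemma nn_integral_abs_power_exp_le:
  fixes c :: real
  assumes c: "c > 0"
  shows "(\<integral>\<^sup>+y. ennreal (\<bar>y\<bar> ^ k * exp (- (c * \<bar>y\<bar>))) \<partial>lborel) \<le> ennreal (2 * fact k / c ^ Suc k)"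
proof -
  \<comment> \<open>The Gamma integrand on the half-line, with integral \<open>fact k\<close>; the
    arguments \<open>c * y\<close> and \<open>- c * y\<close> cover the two half-lines.\<close>
  define h :: "real \<Rightarrow> ennreal" where "h = (\<lambda>t. ennreal (t ^ k * exp (- t)) * indicator {0..} t)"
  have [measurable]: "h \<in> borel_measurable borel"
    unfolding h_def by measurable
  have h: "(\<integral>\<^sup>+y. h y \<partial>lborel) = ennreal (fact k)"
    using nn_intergal_power_times_exp_Ici[of k] by (simp add: h_def)
  have hs: "(\<integral>\<^sup>+y. h (a * y) \<partial>lborel) = ennreal (fact k / \<bar>a\<bar>)" if "a \<noteq> 0" for a
  proof -
    have "ennreal (fact k) = ennreal \<bar>a\<bar> * (\<integral>\<^sup>+y. h (a * y) \<partial>lborel)"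
      using nn_integral_real_affine[of h a 0] that h by simp
    then have "ennreal (1 / \<bar>a\<bar>) * ennreal (fact k)
        = ennreal (1 / \<bar>a\<bar>) * ennreal \<bar>a\<bar> * (\<integral>\<^sup>+y. h (a * y) \<partial>lborel)"
      by (simp add: mult.assoc)
    then show ?thesis
      using that by (simp flip: ennreal_mult)
  qed
  have "(\<integral>\<^sup>+y. ennreal (\<bar>y\<bar> ^ k * exp (- (c * \<bar>y\<bar>))) \<partial>lborel)
      \<le> (\<integral>\<^sup>+y. ennreal (1 / c ^ k) * (h (c * y) + h (- c * y)) \<partial>lborel)"
  proof (rule nn_integral_mono)
    fix y :: real
    have "ennreal (\<bar>y\<bar> ^ k * exp (- (c * \<bar>y\<bar>))) = ennreal (1 / c ^ k) * h (c * \<bar>y\<bar>)"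
      using c by (simp add: h_def power_mult_distrib flip: ennreal_mult)
    also have "\<dots> \<le> ennreal (1 / c ^ k) * (h (c * y) + h (- c * y))"
      by (intro mult_left_mono) (auto simp: abs_if)
    finally show "ennreal (\<bar>y\<bar> ^ k * exp (- (c * \<bar>y\<bar>))) \<le> ennreal (1 / c ^ k) * (h (c * y) + h (- c * y))" .
  qed
  also have "\<dots> = ennreal (1 / c ^ k) * (ennreal (fact k / c) + ennreal (fact k / c))"
    using hs[of c] hs[of "-c"] c by (simp add: nn_integral_cmult nn_integral_add)
  also have "\<dots> = ennreal (2 * fact k / c ^ Suc k)"
    using c by (simp flip: ennreal_plus ennreal_mult)
  finally show ?thesis .
qed

text \<open>Here \<open>1536 = 2 \<cdot> 4! \<cdot> 2\<^sup>5\<close> comes from \<open>\<integral> y\<^sup>4 exp(-D|y|/2) dy\<close>.\<close>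
lemma slice_moments:
  fixes \<phi> :: "real \<Rightarrow> ennreal" and D :: real and a :: ennreal
  assumes [measurable]: "\<phi> \<in> borel_measurable borel"
    and D: "D > 0" and a: "a \<noteq> 0" "a \<noteq> \<infinity>"
    and lo: "\<And>y. \<bar>y\<bar> \<le> 1 / (2 * D) \<Longrightarrow> ennreal (exp (- 1)) * a \<le> \<phi> y"
    and up: "\<And>y. \<phi> y \<le> ennreal (exp (3 / 2 - D * \<bar>y\<bar> / 2)) * a"
  defines "V \<equiv> \<integral>\<^sup>+y. \<phi> y \<partial>lborel"
  shows "V \<noteq> 0" "V \<noteq> \<infinity>"
    "(\<integral>\<^sup>+y. ennreal (y ^ 4) * \<phi> y \<partial>lborel) \<le> ennreal (1536 * exp (5 / 2) / D ^ 4) * V"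
    "ennreal (exp (- 5 / 2) / 256 / D ^ 2) * V \<le> (\<integral>\<^sup>+y. ennreal (y ^ 2) * \<phi> y \<partial>lborel)"
proof -
  obtain A where A: "a = ennreal A" "A > 0"
    using a by (cases a) (auto simp: top_ennreal_def[symmetric] infinity_ennreal_def order_le_less)
  \<comment> \<open>Upper bounds on all absolute moments come from the exponential majorant;
    \<open>k = 0\<close> bounds \<open>V\<close>.\<close>
  have mom_le: "(\<integral>\<^sup>+y. ennreal (\<bar>y\<bar> ^ k) * \<phi> y \<partial>lborel) \<le> ennreal (A * exp (3 / 2) * (2 * fact k * 2 ^ Suc k) / D ^ Suc k)" for k
  proof -
    have "(\<integral>\<^sup>+y. ennreal (\<bar>y\<bar> ^ k) * \<phi> y \<partial>lborel)
        \<le> (\<integral>\<^sup>+y. ennreal (A * exp (3 / 2)) * ennreal (\<bar>y\<bar> ^ k * exp (- (D / 2 * \<bar>y\<bar>))) \<partial>lborel)"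
    proof (rule nn_integral_mono)
      fix y :: real
      have "ennreal (\<bar>y\<bar> ^ k) * \<phi> y \<le> ennreal (\<bar>y\<bar> ^ k) * (ennreal (exp (3 / 2 - D * \<bar>y\<bar> / 2)) * a)"
        by (intro mult_left_mono up) simp
      also have "\<dots> = ennreal (A * exp (3 / 2)) * ennreal (\<bar>y\<bar> ^ k * exp (- (D / 2 * \<bar>y\<bar>)))"
      proof -
        have "exp (3 / 2 - D * \<bar>y\<bar> / 2) = exp (3 / 2) * exp (- (D / 2 * \<bar>y\<bar>))"
          by (simp flip: exp_add)
        then show ?thesis
          using A by (simp add: mult_ac flip: ennreal_mult)
      qed
      finally show "ennreal (\<bar>y\<bar> ^ k) * \<phi> y
        \<le> ennreal (A * exp (3 / 2)) * ennreal (\<bar>y\<bar> ^ k * exp (- (D / 2 * \<bar>y\<bar>)))" .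
    qed
    also have "\<dots> = ennreal (A * exp (3 / 2)) * (\<integral>\<^sup>+y. ennreal (\<bar>y\<bar> ^ k * exp (- (D / 2 * \<bar>y\<bar>))) \<partial>lborel)"
      by (rule nn_integral_cmult) simp
    also have "\<dots> \<le> ennreal (A * exp (3 / 2)) * ennreal (2 * fact k / (D / 2) ^ Suc k)"
      using D by (intro mult_left_mono nn_integral_abs_power_exp_le) auto
    also have "\<dots> = ennreal (A * exp (3 / 2) * (2 * fact k * 2 ^ Suc k) / D ^ Suc k)"
      using A D by (subst ennreal_mult[symmetric]) (auto simp: power_divide)
    finally show ?thesis .
  qed
  have V_le: "V \<le> ennreal (4 * A * exp (3 / 2) / D)"
    using mom_le[of 0] by (simp add: V_def mult_ac)
  then show "V \<noteq> \<infinity>"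
    by (auto simp: top_unique)
  \<comment> \<open>Lower bounds come from a short interval inside the region where
    \<open>\<phi>\<close> is at least \<open>exp (- 1) * a\<close>.\<close>
  have part: "ennreal (t ^ k * (exp (- 1) * A) * (r - t)) \<le> (\<integral>\<^sup>+y. ennreal (\<bar>y\<bar> ^ k) * \<phi> y * indicator {t..r} y \<partial>lborel)"
    if "0 \<le> t" "t \<le> r" "r \<le> 1 / (2 * D)" for t r k
  proof -
    have "ennreal (t ^ k * (exp (- 1) * A) * (r - t)) = (\<integral>\<^sup>+y. ennreal (t ^ k * (exp (- 1) * A)) * indicator {t..r} y \<partial>lborel)"
      using that A by (simp add: nn_integral_cmult_indicator ennreal_mult)
    also have "\<dots> \<le> (\<integral>\<^sup>+y. ennreal (\<bar>y\<bar> ^ k) * \<phi> y * indicator {t..r} y \<partial>lborel)"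
    proof (rule nn_integral_mono)
      fix y :: real
      show "ennreal (t ^ k * (exp (- 1) * A)) * indicator {t..r} y \<le> ennreal (\<bar>y\<bar> ^ k) * \<phi> y * indicator {t..r} y"
      proof (cases "y \<in> {t..r}")
        case True
        then have "ennreal (t ^ k) * (ennreal (exp (- 1)) * a) \<le> ennreal (\<bar>y\<bar> ^ k) * \<phi> y"
          using that by (intro mult_mono lo ennreal_leI power_mono) auto
        then show ?thesis
          using True A that by (simp flip: ennreal_mult)
      qed simp
    qed
    finally show ?thesis .
  qed
  have V_ge: "ennreal (exp (- 1) * A / D) \<le> V"
  proof -
    have "ennreal (exp (- 1) * A / D) = (\<integral>\<^sup>+y. ennreal (exp (- 1) * A) * indicator {- (1 / (2 * D))..1 / (2 * D)} y \<partial>lborel)"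
      using D A by (simp add: nn_integral_cmult_indicator flip: ennreal_mult)
    also have "\<dots> \<le> V"
      unfolding V_def
    proof (rule nn_integral_mono)
      fix y :: real
      show "ennreal (exp (- 1) * A) * indicator {- (1 / (2 * D))..1 / (2 * D)} y \<le> \<phi> y"
        using lo[of y] A by (auto simp: indicator_def abs_le_iff simp flip: ennreal_mult)
    qed
    finally show ?thesis .
  qed
  then show "V \<noteq> 0"
    using A D by (auto simp: ennreal_eq_0_iff not_le field_simps mult_le_0_iff)
  have "(\<integral>\<^sup>+y. ennreal (y ^ 4) * \<phi> y \<partial>lborel) \<le> ennreal (1536 * A * exp (3 / 2) / D ^ 5)"
    using mom_le[of 4] by (simp add: mult_ac fact_numeral eval_nat_numeral)
  \<comment> \<open>A factor \<open>A / D\<close> is traded for \<open>V\<close> by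
    \<open>V_ge\<close> at the cost of \<open>exp 1\<close>, which turns \<open>exp (3 / 2)\<close>
    into \<open>exp (5 / 2)\<close>.\<close>
  also have "\<dots> = ennreal (1536 * exp (5 / 2) / D ^ 4) * ennreal (exp (- 1) * A / D)"
  proof -
    have "exp (5 / 2) * exp (- 1) = exp (3 / 2 :: real)"
      by (simp flip: exp_add)
    then show ?thesis
      using A D by (subst ennreal_mult[symmetric]) (auto simp: field_simps eval_nat_numeral)
  qed
  also have "\<dots> \<le> ennreal (1536 * exp (5 / 2) / D ^ 4) * V"
    by (intro mult_left_mono V_ge) simp
  finally show "(\<integral>\<^sup>+y. ennreal (y ^ 4) * \<phi> y \<partial>lborel) \<le> ennreal (1536 * exp (5 / 2) / D ^ 4) * V" .
  have "ennreal (exp (- 5 / 2) / 256 / D ^ 2) * V \<le> ennreal (exp (- 5 / 2) / 256 / D ^ 2) * ennreal (4 * A * exp (3 / 2) / D)"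
    by (intro mult_left_mono V_le) simp
  \<comment> \<open>Between \<open>1 / (4 * D)\<close> and \<open>1 / (2 * D)\<close> the square is
    at least \<open>1 / (16 * D ^ 2)\<close>, so the integral there is at least
    \<open>exp (- 1) * A / (64 * D ^ 3)\<close>. Dividing by the bound
    \<open>4 * A * exp (3 / 2) / D\<close> on \<open>V\<close> gives the constant
    \<open>exp (- 5 / 2) / 256\<close>.\<close>
  also have "\<dots> = ennreal ((1 / (4 * D)) ^ 2 * (exp (- 1) * A) * (1 / (2 * D) - 1 / (4 * D)))"
  proof -
    have "exp (- 5 / 2) * exp (3 / 2) = exp (- 1 :: real)"
      by (simp flip: exp_add)
    then show ?thesis
      using A D by (subst ennreal_mult[symmetric]) (auto simp: field_simps eval_nat_numeral)
  qed
  also have "\<dots> \<le> (\<integral>\<^sup>+y. ennreal (\<bar>y\<bar> ^ 2) * \<phi> y * indicator {1 / (4 * D)..1 / (2 * D)} y \<partial>lborel)"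
    using D by (intro part) (auto simp: field_simps)
  also have "\<dots> \<le> (\<integral>\<^sup>+y. ennreal (y ^ 2) * \<phi> y \<partial>lborel)"
    by (intro nn_integral_mono) (auto simp: indicator_def)
  finally show "ennreal (exp (- 5 / 2) / 256 / D ^ 2) * V \<le> (\<integral>\<^sup>+y. ennreal (y ^ 2) * \<phi> y \<partial>lborel)" .
qed

section \<open>Slicing the ball along one coordinate\<close>

lemma space_Rd: "space (Rd d) = {..<d} \<rightarrow>\<^sub>E UNIV"
  by (simp add: Rd_def space_PiM)

lemma measurable_Rd_component: "i < d \<Longrightarrow> (\<lambda>v. v i) \<in> borel_measurable (Rd d)"
  unfolding Rd_def by measurable

lemma sets_lp_ball[measurable]:
  assumes "p \<ge> 1"
  shows "lp_ball p d \<in> sets (Rd d)"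
proof (cases rule: ereal_ge_1_cases[OF assms])
  case 1
  then show ?thesis
    unfolding Rd_def by (simp add: lp_ball_def lp_norm_infty_le_iff Rd_def) measurable
next
  case (2 a)
  then show ?thesis
    unfolding Rd_def by (simp add: lp_ball_def lp_norm_ereal_le_1_iff Rd_def) measurable
qed

text \<open>Tonelli's theorem with coordinate \<open>i\<close> integrated outermost: the slice
  volume \<open>\<phi>\<close> is the unnormalised density of that coordinate.\<close>

lemma nn_integral_lp_ball_slice:
  fixes h :: "real \<Rightarrow> ennreal"
  assumes p: "p \<ge> 1" and i: "i < d" and [measurable]: "h \<in> borel_measurable borel"
  defines "P \<equiv> Pi\<^sub>M ({..<d} - {i}) (\<lambda>_. lborel)"
  defines "\<phi> \<equiv> \<lambda>y. emeasure P {x \<in> space P. x(i := y) \<in> lp_ball p d}"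
  shows "\<phi> \<in> borel_measurable borel"
    and "(\<integral>\<^sup>+v. h (v i) * indicator (lp_ball p d) v \<partial>Rd d) = (\<integral>\<^sup>+y. h y * \<phi> y \<partial>lborel)"
proof -
  interpret product_sigma_finite "\<lambda>_::nat. lborel :: real measure" by standard
  interpret finite_product_sigma_finite "\<lambda>_::nat. lborel :: real measure" "{..<d} - {i}" by standard simp
  have ins: "insert i ({..<d} - {i}) = {..<d}" using i by auto
  have upd: "(\<lambda>(x, y). x(i := y)) \<in> measurable (P \<Otimes>\<^sub>M lborel) (Rd d)"
    using measurable_add_dim[of i "{..<d} - {i}" "\<lambda>_. lborel"] unfolding P_def Rd_def ins .
  have [measurable]: "lp_ball p d \<in> sets (Rd d)" using p by simp
  have updy: "(\<lambda>x. x(i := y)) \<in> measurable P (Rd d)" for y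
    using measurable_compose[OF measurable_Pair2'[of y lborel P] upd] by (simp add: comp_def)
  have slice: "\<phi> y = (\<integral>\<^sup>+x. indicator (lp_ball p d) (x(i := y)) \<partial>P)" for y
  proof -
    have "{x \<in> space P. x(i := y) \<in> lp_ball p d} \<in> sets P"
      using measurable_sets[OF updy, of "lp_ball p d"] by (simp add: vimage_def Collect_conj_eq Int_commute)
    then have "\<phi> y = (\<integral>\<^sup>+x. indicator {x \<in> space P. x(i := y) \<in> lp_ball p d} x \<partial>P)"
      by (simp add: \<phi>_def)
    also have "\<dots> = (\<integral>\<^sup>+x. indicator (lp_ball p d) (x(i := y)) \<partial>P)"
      by (intro nn_integral_cong) (auto simp: indicator_def)
    finally show ?thesis .
  qed
  have "sigma_finite_measure P"
    unfolding P_def by (rule sigma_finite_measure_axioms)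
  moreover have "(\<lambda>(y, x). indicator (lp_ball p d) (x(i := y)) :: ennreal) \<in> borel_measurable (borel \<Otimes>\<^sub>M P)"
    using measurable_compose[OF measurable_compose[OF measurable_pair_swap' upd], of "indicator (lp_ball p d)" "borel :: ennreal measure"]
    by (simp add: case_prod_beta cong: measurable_cong_sets)
  ultimately show "\<phi> \<in> borel_measurable borel"
    unfolding slice by (intro sigma_finite_measure.borel_measurable_nn_integral) auto
  have "(\<integral>\<^sup>+v. h (v i) * indicator (lp_ball p d) v \<partial>Rd d)
      = (\<integral>\<^sup>+v. h (v i) * indicator (lp_ball p d) v \<partial>Pi\<^sub>M (insert i ({..<d} - {i})) (\<lambda>_. lborel))"
    unfolding ins Rd_def ..
  also have "\<dots> = (\<integral>\<^sup>+y. \<integral>\<^sup>+x. h y * indicator (lp_ball p d) (x(i := y)) \<partial>P \<partial>lborel)"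
  proof (subst product_nn_integral_insert_rev)
    show "(\<lambda>v. h (v i) * indicator (lp_ball p d) v) \<in> borel_measurable (Pi\<^sub>M (insert i ({..<d} - {i})) (\<lambda>_. lborel))"
      unfolding ins Rd_def[symmetric] using i measurable_Rd_component[OF i] by measurable
  qed (auto simp: P_def)
  also have "\<dots> = (\<integral>\<^sup>+y. h y * \<phi> y \<partial>lborel)"
  proof (rule nn_integral_cong)
    fix y :: real
    have "(\<lambda>x. indicator (lp_ball p d) (x(i := y)) :: ennreal) \<in> borel_measurable P"
      using measurable_compose[OF updy, of "indicator (lp_ball p d)" borel] by simp
    then show "(\<integral>\<^sup>+x. h y * indicator (lp_ball p d) (x(i := y)) \<partial>P) = h y * \<phi> y"
      unfolding slice by (rule nn_integral_cmult)
  qed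
  finally show "(\<integral>\<^sup>+v. h (v i) * indicator (lp_ball p d) v \<partial>Rd d) = (\<integral>\<^sup>+y. h y * \<phi> y \<partial>lborel)" .
qed

lemma emeasure_PiM_lborel_cube:
  fixes t :: real
  assumes "finite J" "t \<ge> 0"
  shows "emeasure (Pi\<^sub>M J (\<lambda>_. lborel)) (\<Pi>\<^sub>E j\<in>J. {-t..t}) = ennreal ((2 * t) ^ card J)"
proof -
  interpret product_sigma_finite "\<lambda>_::'a. lborel :: real measure" by standard
  show ?thesis
    using assms by (simp add: emeasure_PiM ennreal_power)
qed

text \<open>The ball lies between two cubes. Nondegeneracy is enough, because the volume only serves
  as a reference value that cancels after normalisation.\<close>

lemma emeasure_powr_ball_bounds:
  fixes a :: real
  assumes J: "finite J" and a: "a \<ge> 1"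
  defines "P \<equiv> Pi\<^sub>M J (\<lambda>_. lborel)"
  defines "E \<equiv> emeasure P {v \<in> space P. (\<Sum>j\<in>J. \<bar>v j\<bar> powr a) \<le> 1}"
  shows "E \<noteq> 0" "E \<noteq> \<infinity>"
proof -
  have [measurable]: "{v \<in> space P. (\<Sum>j\<in>J. \<bar>v j\<bar> powr a) \<le> 1} \<in> sets P"
    unfolding P_def by measurable
  \<comment> \<open>With this half-side a sum of \<open>card J\<close> terms of size at most
    \<open>t\<close> stays below 1, since
    \<open>\<bar>v j\<bar> powr a \<le> \<bar>v j\<bar>\<close> here; the \<open>+ 1\<close> allows
    empty \<open>J\<close>.\<close>
  define t :: real where "t = 1 / (card J + 1)"
  have t: "0 < t" "t \<le> 1" by (auto simp: t_def)
  have cubes: "(\<Pi>\<^sub>E j\<in>J. {-s..s}) \<in> sets P" for s :: real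
    unfolding P_def using J by (intro sets_PiM_I_finite) auto
  have "(\<Pi>\<^sub>E j\<in>J. {-t..t}) \<subseteq> {v \<in> space P. (\<Sum>j\<in>J. \<bar>v j\<bar> powr a) \<le> 1}"
  proof safe
    fix v assume v: "v \<in> (\<Pi>\<^sub>E j\<in>J. {-t..t})"
    then show "v \<in> space P" by (auto simp: P_def space_PiM PiE_iff)
    have "(\<Sum>j\<in>J. \<bar>v j\<bar> powr a) \<le> (\<Sum>j\<in>J. t)"
    proof (rule sum_mono)
      fix j assume "j \<in> J"
      then have "v j \<in> {-t..t}" using v by (auto simp: PiE_iff)
      then have vj: "\<bar>v j\<bar> \<le> t" by auto
      then have "\<bar>v j\<bar> powr a \<le> \<bar>v j\<bar> powr 1" using a t by (intro powr_mono') auto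
      then show "\<bar>v j\<bar> powr a \<le> t" using vj by simp
    qed
    also have "\<dots> \<le> 1" by (simp add: t_def)
    finally show "(\<Sum>j\<in>J. \<bar>v j\<bar> powr a) \<le> 1" .
  qed
  then have "ennreal ((2 * t) ^ card J) \<le> E"
    using emeasure_mono[of "\<Pi>\<^sub>E j\<in>J. {-t..t}" "{v \<in> space P. (\<Sum>j\<in>J. \<bar>v j\<bar> powr a) \<le> 1}" P]
      emeasure_PiM_lborel_cube[OF J, of t] t by (simp add: E_def P_def)
  moreover have "0 < ennreal ((2 * t) ^ card J)"
    using t by (simp only: ennreal_less_zero_iff) simp
  ultimately have "0 < E" by (rule less_le_trans[rotated])
  then show "E \<noteq> 0" by simp
  have "{v \<in> space P. (\<Sum>j\<in>J. \<bar>v j\<bar> powr a) \<le> 1} \<subseteq> (\<Pi>\<^sub>E j\<in>J. {-1..1})"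
  proof
    fix v assume "v \<in> {v \<in> space P. (\<Sum>j\<in>J. \<bar>v j\<bar> powr a) \<le> 1}"
    then have v: "v \<in> space P" "(\<Sum>j\<in>J. \<bar>v j\<bar> powr a) \<le> 1" by auto
    have "v j \<in> {-1..1}" if "j \<in> J" for j
    proof -
      have "\<bar>v j\<bar> powr a \<le> (\<Sum>j\<in>J. \<bar>v j\<bar> powr a)"
        using that J by (intro member_le_sum) auto
      then have "\<bar>v j\<bar> powr a \<le> 1" using v by simp
      then have "\<bar>v j\<bar> \<le> 1"
        using powr_mono2[of "1 / a" "\<bar>v j\<bar> powr a" 1] a by (simp add: powr_powr)
      then show ?thesis by auto
    qed
    then show "v \<in> (\<Pi>\<^sub>E j\<in>J. {-1..1})" using v(1) by (auto simp: P_def space_PiM PiE_iff)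
  qed
  then have "E \<le> ennreal (2 ^ card J)"
    using emeasure_mono[OF _ cubes[of 1], of "{v \<in> space P. (\<Sum>j\<in>J. \<bar>v j\<bar> powr a) \<le> 1}"]
      emeasure_PiM_lborel_cube[OF J, of 1] by (simp add: E_def P_def)
  then show "E \<noteq> \<infinity>" by (auto simp: top_unique)
qed

text \<open>For \<open>s \<ge> 3\<close>, and thus \<open>s \<ge> exp 1\<close>, one has
  \<open>s powr (a - 1) \<ge> exp (a - 1) \<ge> a\<close>. The linear lower bound, uniform in
  \<open>a\<close>, is what makes the decay of the slices uniform in \<open>p\<close>.\<close>

lemma powr_div_ge:
  fixes s a :: real
  assumes "s \<ge> 0" "a \<ge> 1"
  shows "s - 3 \<le> s powr a / a"
proof (cases "s \<le> 3")
  case True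
  moreover have "0 \<le> s powr a / a" using assms by simp
  ultimately show ?thesis by linarith
next
  case False
  have "a \<le> exp (a - 1)" using exp_ge_add_one_self[of "a - 1"] by simp
  also have "\<dots> \<le> exp (ln s * (a - 1))"
  proof -
    have "exp 1 \<le> s" using False exp_le by simp
    then have "1 \<le> ln s" using False by (simp add: ln_ge_iff)
    then have "1 * (a - 1) \<le> ln s * (a - 1)" using assms by (intro mult_right_mono) auto
    then show ?thesis by simp
  qed
  also have "\<dots> = s powr a / s" using False by (simp add: powr_def exp_diff algebra_simps)
  finally have "s \<le> s powr a / a" using False assms by (simp add: field_simps)
  then show ?thesis by simp
qed

text \<open>The reference \<open>A\<close> is the volume of the central slice. For
  \<open>p = \<infinity>\<close> the slices are one fixed cube, or empty. For finite
  \<open>p\<close> the slice is a smaller ball of the same shape, and both bounds follow by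
  comparing it with a ball whose radius \<open>u\<close> is an exponential.\<close>

lemma emeasure_lp_ball_slice:
  assumes p: "p \<ge> 1" and i: "i < d"
  defines "P \<equiv> Pi\<^sub>M ({..<d} - {i}) (\<lambda>_. lborel)"
  defines "\<phi> \<equiv> \<lambda>y. emeasure P {x \<in> space P. x(i := y) \<in> lp_ball p d}"
  obtains A where "A \<noteq> 0" "A \<noteq> \<infinity>"
    "\<And>y. \<bar>y\<bar> \<le> 1 / (2 * d_pow p d) \<Longrightarrow> ennreal (exp (- 1)) * A \<le> \<phi> y"
    "\<And>y. \<phi> y \<le> ennreal (exp (3 / 2 - d_pow p d * \<bar>y\<bar> / 2)) * A"
proof (cases rule: ereal_ge_1_cases[OF p])
  let ?J = "{..<d} - {i}"
  have ext: "x(i := y) \<in> space (Rd d)" if "x \<in> space P" for x and y :: real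
    using that i by (auto simp: P_def space_Rd space_PiM PiE_iff extensional_def)
  have sumJ: "(\<Sum>j<d. g ((x(i := y)) j)) = g y + (\<Sum>j\<in>?J. g (x j))" for g :: "real \<Rightarrow> real" and x y
    using i by (subst sum.remove[of _ i]) auto
  {
    case 1
    define A where "A = emeasure P (\<Pi>\<^sub>E j\<in>?J. {-1..1})"
    have A: "A = ennreal (2 ^ card ?J)"
      using emeasure_PiM_lborel_cube[of ?J 1] by (simp add: A_def P_def)
    have D: "d_pow p d = 1" using 1 by (simp add: d_pow_def)
    have \<phi>: "\<phi> y = (if \<bar>y\<bar> \<le> 1 then A else 0)" for y
    proof -
      have "x(i := y) \<in> lp_ball p d \<longleftrightarrow> \<bar>y\<bar> \<le> 1 \<and> (\<forall>j\<in>?J. x j \<in> {-1..1})" if "x \<in> space P" for x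
        using ext[OF that, of y] 1 i by (auto simp: lp_ball_def lp_norm_infty_le_iff abs_le_iff)
      then have "{x \<in> space P. x(i := y) \<in> lp_ball p d}
          = {x \<in> space P. \<bar>y\<bar> \<le> 1 \<and> (\<forall>j\<in>?J. x j \<in> {-1..1})}"
        by (intro Collect_cong) blast
      also have "\<dots> = (if \<bar>y\<bar> \<le> 1 then \<Pi>\<^sub>E j\<in>?J. {-1..1} else {})"
      proof -
        have "{x \<in> Pi\<^sub>E A (\<lambda>_. UNIV). \<forall>j\<in>A. x j \<in> B} = Pi\<^sub>E A (\<lambda>_. B)"
          for A :: "nat set" and B :: "real set"
          by (auto simp: PiE_iff dest: extensional_arb)
        from this[of ?J "{-1..1}"] show ?thesis
          by (cases "\<bar>y\<bar> \<le> 1") (simp_all only: P_def space_PiM space_lborel space_borel if_True if_False simp_thms Collect_empty_eq not_False_eq_True)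
      qed
      finally show ?thesis by (simp add: \<phi>_def A_def)
    qed
    show ?thesis
    proof (rule that[of A])
      show "A \<noteq> 0" "A \<noteq> \<infinity>" unfolding A by (auto simp: ennreal_eq_0_iff not_le)
      show "ennreal (exp (- 1)) * A \<le> \<phi> y" if "\<bar>y\<bar> \<le> 1 / (2 * d_pow p d)" for y
        using that mult_right_mono[of "ennreal (exp (- 1))" 1 A] by (simp add: \<phi> D)
      \<comment> \<open>The exponent is at least 1 for \<open>\<bar>y\<bar> \<le> 1\<close>, and
        beyond that the slice is empty.\<close>
      show "\<phi> y \<le> ennreal (exp (3 / 2 - d_pow p d * \<bar>y\<bar> / 2)) * A" for y
        using mult_right_mono[of 1 "ennreal (exp (3 / 2 - \<bar>y\<bar> / 2))" A] by (simp add: \<phi> D)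
    qed
  next
    case (2 a)
    define S where "S = (\<lambda>t. {x \<in> space P. (\<Sum>j\<in>?J. \<bar>x j\<bar> powr a) \<le> t})"
    have S[measurable]: "S t \<in> sets P" for t
      unfolding S_def P_def by measurable
    define A where "A = emeasure P (S 1)"
    have d: "d \<ge> 1" using i by simp
    have D: "d_pow p d > 0" "d_pow p d powr a = d"
      using 2 d by (auto simp: d_pow_def powr_powr)
    have \<phi>: "\<phi> y = emeasure P (S (1 - \<bar>y\<bar> powr a))" for y
    proof -
      have "x(i := y) \<in> lp_ball p d \<longleftrightarrow> (\<Sum>j\<in>?J. \<bar>x j\<bar> powr a) \<le> 1 - \<bar>y\<bar> powr a" if "x \<in> space P" for x
        using ext[OF that, of y] 2 sumJ[of "\<lambda>t. \<bar>t\<bar> powr a" x y] by (auto simp: lp_ball_def lp_norm_ereal_le_1_iff)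
      then show ?thesis by (auto simp: \<phi>_def S_def intro!: arg_cong[of _ _ "emeasure P"])
    qed
    have scale: "emeasure P (S (u powr a)) = ennreal (u ^ (d - 1)) * A" if "u > 0" for u
      using emeasure_powr_ball_scale[of ?J u a] that i by (simp add: S_def A_def P_def)
    \<comment> \<open>Monotonicity also covers \<open>t \<le> 0\<close>, where \<open>scale\<close>
      does not apply.\<close>
    have Smono: "emeasure P (S t) \<le> emeasure P (S t')" if "t \<le> t'" for t t'
      using that by (intro emeasure_mono S) (auto simp: S_def)
    show ?thesis
    proof (rule that[of A])
      show "A \<noteq> 0" "A \<noteq> \<infinity>"
        unfolding A_def S_def P_def using emeasure_powr_ball_bounds[of ?J a] 2 by auto
    next
      fix y :: real assume y: "\<bar>y\<bar> \<le> 1 / (2 * d_pow p d)"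
      \<comment> \<open>This radius is small enough to fit, as \<open>u powr a = exp (- (1 / d))
        \<le> d / (d + 1) \<le> 1 - 1 / (2 * d)\<close>, yet
        \<open>u ^ (d - 1) \<ge> exp (- 1)\<close>.\<close>
      define u where "u = exp (- (1 / (d * a)))"
      have "\<bar>y\<bar> powr a \<le> (1 / (2 * d_pow p d)) powr a"
        using y 2 by (intro powr_mono2) auto
      also have "\<dots> = 1 / (2 powr a * d)" using D by (simp add: powr_divide powr_mult)
      also have "\<dots> \<le> 1 / (2 * d)"
        using powr_mono[of 1 a 2] 2 d by (intro divide_left_mono mult_right_mono) auto
      finally have y_le: "\<bar>y\<bar> powr a \<le> 1 / (2 * d)" .
      have "u powr a = exp (- (1 / d))"
        using 2 by (simp add: u_def exp_powr_real)
      also have "\<dots> = inverse (exp (1 / d))"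
        by (simp add: exp_minus)
      also have "\<dots> \<le> inverse (1 + 1 / d)"
        using exp_ge_add_one_self[of "1 / d"] by (intro le_imp_inverse_le) (auto simp: add_pos_nonneg)
      also have "\<dots> \<le> 1 - 1 / (2 * d)"
        using d by (simp add: field_simps)
      also have "\<dots> \<le> 1 - \<bar>y\<bar> powr a" using y_le by simp
      finally have u_le: "u powr a \<le> 1 - \<bar>y\<bar> powr a" .
      have "(d - 1) * (1 / (d * a)) \<le> d * (1 / (d * a))"
        using 2 by (intro mult_right_mono) auto
      also have "\<dots> = 1 / a" using d by simp
      also have "\<dots> \<le> 1" using 2 by simp
      finally have "exp (- 1) \<le> exp (- ((d - 1) * (1 / (d * a))))" by simp
      also have "\<dots> = u ^ (d - 1)" by (simp add: u_def flip: exp_of_nat_mult)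
      finally have "ennreal (exp (- 1)) * A \<le> ennreal (u ^ (d - 1)) * A"
        by (intro mult_right_mono ennreal_leI) auto
      also have "\<dots> \<le> \<phi> y"
        unfolding \<phi> using u_le by (subst scale[symmetric]) (auto simp: u_def intro!: Smono)
      finally show "ennreal (exp (- 1)) * A \<le> \<phi> y" .
    next
      fix y :: real
      show "\<phi> y \<le> ennreal (exp (3 / 2 - d_pow p d * \<bar>y\<bar> / 2)) * A"
      \<comment> \<open>For \<open>d = 1\<close> the scaling factor \<open>u ^ (d - 1)\<close> gives
        no decay; there the slice is simply empty for \<open>\<bar>y\<bar> > 1\<close>.\<close>
      proof (cases "d = 1")
        case True
        then have J: "?J = {}" using i by auto
        have D1: "d_pow p d = 1" using True by (simp add: d_pow_def)
        show ?thesis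
        proof (cases "\<bar>y\<bar> \<le> 1")
          case True
          have "\<phi> y \<le> 1 * A" unfolding \<phi> A_def mult_1 by (intro Smono) simp
          also have "\<dots> \<le> ennreal (exp (3 / 2 - d_pow p d * \<bar>y\<bar> / 2)) * A"
            using True D1 by (intro mult_right_mono) auto
          finally show ?thesis .
        next
          case False
          then have "1 < \<bar>y\<bar> powr a" using 2 powr_less_mono2[of a 1 "\<bar>y\<bar>"] by simp
          then have "S (1 - \<bar>y\<bar> powr a) = {}" unfolding S_def J by auto
          then show ?thesis by (simp add: \<phi>)
        qed
      next
        case False
        define u where "u = exp (- (\<bar>y\<bar> powr a / a))"
        have "1 - \<bar>y\<bar> powr a \<le> exp (- (\<bar>y\<bar> powr a))"
          using exp_ge_add_one_self[of "- (\<bar>y\<bar> powr a)"] by simp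
        also have "\<dots> = u powr a" using 2 by (simp add: u_def exp_powr_real)
        finally have "\<phi> y \<le> emeasure P (S (u powr a))" unfolding \<phi> by (rule Smono)
        also have "\<dots> = ennreal (u ^ (d - 1)) * A" by (intro scale) (simp add: u_def)
        also have "\<dots> \<le> ennreal (exp (3 / 2 - d_pow p d * \<bar>y\<bar> / 2)) * A"
        proof (intro mult_right_mono ennreal_leI)
          have "d_pow p d * \<bar>y\<bar> - 3 \<le> (d_pow p d * \<bar>y\<bar>) powr a / a"
            using D 2 by (intro powr_div_ge) auto
          also have "\<dots> = d * (\<bar>y\<bar> powr a / a)" using D by (simp add: powr_mult)
          \<comment> \<open>Passing from \<open>d\<close> to \<open>d - 1\<close> costs a factor 2
            when \<open>d \<ge> 2\<close>; this is why the exponent is half of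
            \<open>3 - D * \<bar>y\<bar>\<close>, with \<open>D = d_pow p d\<close>.\<close>
          also have "\<dots> \<le> (2 * (real d - 1)) * (\<bar>y\<bar> powr a / a)"
            using False d 2 by (intro mult_right_mono) auto
          also have "\<dots> = 2 * (real (d - 1) * (\<bar>y\<bar> powr a / a))"
            using d by (simp add: of_nat_diff)
          finally have "- (real (d - 1) * (\<bar>y\<bar> powr a / a)) \<le> 3 / 2 - d_pow p d * \<bar>y\<bar> / 2"
            by linarith
          moreover have "u ^ (d - 1) = exp (- (real (d - 1) * (\<bar>y\<bar> powr a / a)))"
            unfolding u_def by (simp flip: exp_of_nat_mult)
          ultimately show "u ^ (d - 1) \<le> exp (3 / 2 - d_pow p d * \<bar>y\<bar> / 2)" by simp
        qed simp
        finally show ?thesis .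
      qed
    qed
  }
qed

subsection \<open>Moments and tails of linear forms on the unit ball\<close>

locale lp_ball_uniform =
  fixes p :: ereal and d :: nat
  assumes p: "p \<ge> 1" and d: "d \<ge> 1"
begin

definition "U = uniform_measure (Rd d) (lp_ball p d)"
abbreviation "D \<equiv> d_pow p d"

lemma D_pos: "D > 0"
  using d by (rule pos_d_pow)

lemma sets_ball [measurable]: "lp_ball p d \<in> sets (Rd d)"
  using p by (rule sets_lp_ball)

lemma sets_U [simp, measurable_cong]: "sets U = sets (Rd d)"
  by (simp add: U_def)

lemma space_U [simp]: "space U = space (Rd d)"
  by (simp add: U_def)

lemma measurable_U_component [measurable]: "i < d \<Longrightarrow> (\<lambda>v. v i) \<in> borel_measurable U"
  using measurable_Rd_component[of i d] by (simp cong: measurable_cong_sets)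

text \<open>Under \<open>U\<close> the coordinate \<open>v i\<close> has density
  \<open>\<phi> / V\<close>, with \<open>\<phi>\<close> the slice volume and \<open>V\<close> the
  volume of the ball. The volume is itself the slice integral of the constant 1, so the same bounds
  show that the uniform law is well defined.\<close>

lemma nn_moments:
  assumes i: "i < d"
  shows "emeasure (Rd d) (lp_ball p d) \<noteq> 0" "emeasure (Rd d) (lp_ball p d) \<noteq> \<infinity>"
    "(\<integral>\<^sup>+v. ennreal ((v i) ^ 4) \<partial>U) \<le> ennreal (1536 * exp (5 / 2) / D ^ 4)"
    "ennreal (exp (- 5 / 2) / 256 / D ^ 2) \<le> (\<integral>\<^sup>+v. ennreal ((v i) ^ 2) \<partial>U)"
proof -
  define \<phi> where "\<phi> = (\<lambda>y. emeasure (Pi\<^sub>M ({..<d} - {i}) (\<lambda>_. lborel))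
    {x \<in> space (Pi\<^sub>M ({..<d} - {i}) (\<lambda>_. lborel)). x(i := y) \<in> lp_ball p d})"
  have \<phi>: "\<phi> \<in> borel_measurable borel"
    unfolding \<phi>_def by (rule nn_integral_lp_ball_slice(1)[OF p i, of "\<lambda>_. 0"]) simp
  have slice: "(\<integral>\<^sup>+v. h (v i) * indicator (lp_ball p d) v \<partial>Rd d) = (\<integral>\<^sup>+y. h y * \<phi> y \<partial>lborel)"
    if "h \<in> borel_measurable borel" for h
    unfolding \<phi>_def using that by (rule nn_integral_lp_ball_slice(2)[OF p i])
  define V where "V = (\<integral>\<^sup>+y. \<phi> y \<partial>lborel)"
  have V: "emeasure (Rd d) (lp_ball p d) = V"
    using slice[of "\<lambda>_. 1"] by (simp add: V_def)
  obtain A where A: "A \<noteq> 0" "A \<noteq> \<infinity>"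
    "\<And>y. \<bar>y\<bar> \<le> 1 / (2 * D) \<Longrightarrow> ennreal (exp (- 1)) * A \<le> \<phi> y"
    "\<And>y. \<phi> y \<le> ennreal (exp (3 / 2 - D * \<bar>y\<bar> / 2)) * A"
    using emeasure_lp_ball_slice[OF p i] unfolding \<phi>_def by blast
  note mom = slice_moments[OF \<phi> D_pos A, folded V_def]
  show V0: "emeasure (Rd d) (lp_ball p d) \<noteq> 0" and Vi: "emeasure (Rd d) (lp_ball p d) \<noteq> \<infinity>"
    using mom(1,2) V by auto
  have nn: "(\<integral>\<^sup>+v. h (v i) \<partial>U) = (\<integral>\<^sup>+y. h y * \<phi> y \<partial>lborel) / V" if [measurable]: "h \<in> borel_measurable borel" for h
  proof -
    have "(\<lambda>v. h (v i)) \<in> borel_measurable (Rd d)"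
      using measurable_Rd_component[OF i] by measurable
    then show ?thesis
      unfolding U_def using slice[OF that] V by (simp add: nn_integral_uniform_measure)
  qed
  have cancel: "c * V / V = c" for c
    using V0 Vi unfolding V by (simp add: ennreal_mult_divide_eq)
  show "(\<integral>\<^sup>+v. ennreal ((v i) ^ 4) \<partial>U) \<le> ennreal (1536 * exp (5 / 2) / D ^ 4)"
    using divide_right_mono_ennreal[OF mom(3), of V] nn[of "\<lambda>y. ennreal (y ^ 4)"] by (simp add: cancel)
  show "ennreal (exp (- 5 / 2) / 256 / D ^ 2) \<le> (\<integral>\<^sup>+v. ennreal ((v i) ^ 2) \<partial>U)"
    using divide_right_mono_ennreal[OF mom(4), of V] nn[of "\<lambda>y. ennreal (y ^ 2)"] by (simp add: cancel)
qed

lemma prob_space_U: "prob_space U"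
  unfolding U_def using d by (intro prob_space_uniform_measure nn_moments(1,2)[of 0]) auto

sublocale prob_space U
  by (rule prob_space_U)

lemma prob_space_Rd [simp]: "prob (space (Rd d)) = 1"
  using prob_space by simp

section \<open>Integrability and moments of single coordinates\<close>

lemma AE_coord_le_1: "AE v in U. \<forall>i<d. \<bar>v i\<bar> \<le> 1"
  unfolding U_def
  by (intro AE_uniform_measureI sets_ball AE_I2) (auto simp: lp_ball_def intro: lp_norm_le_1_coord[OF p])

lemma integrable_bounded_coords:
  fixes f :: "(nat \<Rightarrow> real) \<Rightarrow> real"
  assumes "f \<in> borel_measurable U" "\<And>v. \<forall>i<d. \<bar>v i\<bar> \<le> 1 \<Longrightarrow> \<bar>f v\<bar> \<le> B"
  shows "integrable U f"
  using AE_coord_le_1 assms by (intro integrable_const_bound[of _ B]) auto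

text \<open>The product of a power of a partial sum and a power of one coordinate is the shape of
  the terms that arise when a linear form is built up one coordinate at a time.\<close>

lemma integrable_linear_monomial:
  assumes n: "n \<le> d" and m: "m < d"
  shows "integrable U (\<lambda>v. (\<Sum>i<n. w i * v i) ^ k * (v m) ^ l)"
proof (rule integrable_bounded_coords)
  have [measurable]: "(\<lambda>v. v i) \<in> borel_measurable U" if "i < n" for i
    using that n by simp
  show "(\<lambda>v. (\<Sum>i<n. w i * v i) ^ k * (v m) ^ l) \<in> borel_measurable U"
    using m by measurable
  fix v :: "nat \<Rightarrow> real" assume v: "\<forall>i<d. \<bar>v i\<bar> \<le> 1"
  have "\<bar>\<Sum>i<n. w i * v i\<bar> \<le> (\<Sum>i<n. \<bar>w i * v i\<bar>)" by (rule sum_abs)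
  also have "\<dots> \<le> (\<Sum>i<n. \<bar>w i\<bar> * 1)"
    unfolding abs_mult using v n by (intro sum_mono mult_left_mono) auto
  finally have "\<bar>\<Sum>i<n. w i * v i\<bar> ^ k * \<bar>v m\<bar> ^ l \<le> (\<Sum>i<n. \<bar>w i\<bar>) ^ k * 1"
    using v m by (intro mult_mono power_mono power_le_one zero_le_power sum_nonneg) auto
  then show "\<bar>(\<Sum>i<n. w i * v i) ^ k * (v m) ^ l\<bar> \<le> (\<Sum>i<n. \<bar>w i\<bar>) ^ k"
    by (simp add: abs_mult power_abs)
qed

lemma integrable_linear_power: "n \<le> d \<Longrightarrow> integrable U (\<lambda>v. (\<Sum>i<n. w i * v i) ^ k)"
  using integrable_linear_monomial[of n 0 w k 0] d by simp

lemma integrable_coord_power: "m < d \<Longrightarrow> integrable U (\<lambda>v. (v m) ^ l)"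
  using integrable_linear_monomial[of 0 m _ 0 l] by simp

lemma fourth_moment_coord_le: "i < d \<Longrightarrow> expectation (\<lambda>v. (v i) ^ 4) \<le> 1536 * exp (5 / 2) / D ^ 4"
  using nn_moments(3)[of i] nn_integral_eq_integral[OF integrable_coord_power[of i 4]]
  by (simp add: ennreal_le_iff)

lemma second_moment_coord_ge: "i < d \<Longrightarrow> exp (- 5 / 2) / 256 / D ^ 2 \<le> expectation (\<lambda>v. (v i) ^ 2)"
  using nn_moments(4)[of i] nn_integral_eq_integral[OF integrable_coord_power[of i 2]]
  by (simp add: ennreal_le_iff)

text \<open>The AM-GM inequality \<open>y^2 \<le> D^2 * y^4 / 2 + 1 / (2 * D^2)\<close> reduces this
  to the fourth moment with the correct order in \<open>D\<close>; the constant survives because it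
  is at least 1.\<close>

lemma second_moment_coord_le:
  assumes i: "i < d"
  shows "expectation (\<lambda>v. (v i) ^ 2) \<le> 1536 * exp (5 / 2) / D ^ 2"
proof -
  have "expectation (\<lambda>v. (v i) ^ 2) \<le> expectation (\<lambda>v. D ^ 2 / 2 * (v i) ^ 4 + 1 / (2 * D ^ 2))"
  proof (rule integral_mono)
    fix v :: "nat \<Rightarrow> real"
    have "0 \<le> (D * (v i)\<^sup>2 - 1 / D)\<^sup>2" by simp
    then show "(v i) ^ 2 \<le> D ^ 2 / 2 * (v i) ^ 4 + 1 / (2 * D ^ 2)"
      using D_pos by (simp add: power2_diff power_mult_distrib power_divide power2_eq_square[of D] field_simps flip: power_mult)
  qed (use i in \<open>auto intro!: Bochner_Integration.integrable_add integrable_mult_right integrable_coord_power\<close>)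
  also have "\<dots> = D ^ 2 / 2 * expectation (\<lambda>v. (v i) ^ 4) + 1 / (2 * D ^ 2)"
    using i by (simp add: integrable_coord_power)
  also have "\<dots> \<le> D ^ 2 / 2 * (1536 * exp (5 / 2) / D ^ 4) + 1 / (2 * D ^ 2)"
    using i by (intro add_right_mono mult_left_mono fourth_moment_coord_le) auto
  also have "\<dots> = (1536 * exp (5 / 2) + 1) / 2 / D ^ 2"
    using D_pos by (simp add: field_simps eval_nat_numeral)
  also have "\<dots> \<le> 1536 * exp (5 / 2) / D ^ 2"
  proof (intro divide_right_mono)
    have *: "(1536 * e + 1) / 2 \<le> 1536 * e" if "1 \<le> e" for e :: real
      using that by simp
    show "(1536 * exp (5 / 2) + 1) / 2 \<le> 1536 * exp (5 / 2 :: real)"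
      by (rule *) simp
  qed simp
  finally show ?thesis .
qed

text \<open>Sign changes of coordinates preserve both Lebesgue measure and the ball, hence the
  uniform law. The restriction to \<open>{..<d}\<close> keeps the reflected vector in the space of
  extensional functions.\<close>

lemma expectation_reflect:
  fixes g :: "(nat \<Rightarrow> real) \<Rightarrow> real"
  assumes s: "\<And>i. i < d \<Longrightarrow> \<bar>s i\<bar> = 1" and g: "g \<in> borel_measurable U"
  shows "expectation (\<lambda>v. g (\<lambda>i\<in>{..<d}. s i * v i)) = expectation g"
proof -
  let ?f = "\<lambda>v. \<lambda>i\<in>{..<d}. s i * v i"
  have f: "?f \<in> measurable (Rd d) (Rd d)"
    unfolding Rd_def by measurable
  have Rd: "distr (Rd d) (Rd d) ?f = Rd d"
  proof -
    have "s i \<noteq> 0" if "i < d" for i using s[OF that] by auto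
    then show ?thesis
      using PiM_lborel_mult[of "{..<d}" s] s by (simp add: Rd_def)
  qed
  have "lp_norm p d (?f v) = lp_norm p d v" for v
    using s by (auto simp: lp_norm_def abs_mult intro!: arg_cong[of _ _ Max] image_cong)
  then have ball: "?f v \<in> lp_ball p d \<longleftrightarrow> v \<in> lp_ball p d" if "v \<in> space (Rd d)" for v
    using that by (auto simp: lp_ball_def space_Rd)
  have fU: "?f \<in> measurable U U"
    using f by (simp cong: measurable_cong_sets)
  have "distr U U ?f = U"
  proof (rule measure_eqI)
    fix X assume "X \<in> sets (distr U U ?f)"
    then have X: "X \<in> sets (Rd d)" by simp
    have pre: "?f -` X \<inter> space (Rd d) \<in> sets (Rd d)"
      using f X by (rule measurable_sets)
    have "emeasure (distr U U ?f) X = emeasure (Rd d) (lp_ball p d \<inter> (?f -` X \<inter> space (Rd d))) / emeasure (Rd d) (lp_ball p d)"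
      using X pre fU by (simp add: emeasure_distr) (simp add: U_def)
    also have "lp_ball p d \<inter> (?f -` X \<inter> space (Rd d)) = ?f -` (lp_ball p d \<inter> X) \<inter> space (Rd d)"
      using ball by blast
    also have "emeasure (Rd d) \<dots> = emeasure (distr (Rd d) (Rd d) ?f) (lp_ball p d \<inter> X)"
      using X by (intro emeasure_distr[symmetric] f) auto
    also have "\<dots> = emeasure (Rd d) (lp_ball p d \<inter> X)"
      by (simp only: Rd)
    also have "\<dots> / emeasure (Rd d) (lp_ball p d) = emeasure U X"
      using X by (simp add: U_def)
    finally show "emeasure (distr U U ?f) X = emeasure U X" .
  qed simp
  then show ?thesis
    using integral_distr[OF fU g] by simp
qed

text \<open>Reflecting coordinate \<open>n\<close> alone negates the integrand, so the expectation
  equals its own negative.\<close>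

lemma odd_moment_eq_0:
  assumes n: "n < d" and l: "odd l"
  shows "expectation (\<lambda>v. (\<Sum>i<n. w i * v i) ^ k * (v n) ^ l) = 0"
proof -
  define g where "g = (\<lambda>v :: nat \<Rightarrow> real. (\<Sum>i<n. w i * v i) ^ k * (v n) ^ l)"
  define s where "s = (\<lambda>i. if i = n then - 1 else 1 :: real)"
  have "g (\<lambda>i\<in>{..<d}. s i * v i) = - g v" for v
    using n l by (simp add: g_def s_def)
  moreover have "g \<in> borel_measurable U"
    using integrable_linear_monomial[of n n w k l] n by (auto simp: g_def)
  then have "expectation (\<lambda>v. g (\<lambda>i\<in>{..<d}. s i * v i)) = expectation g"
    by (intro expectation_reflect) (auto simp: s_def)
  ultimately show ?thesis
    by (simp add: g_def)
qed

text \<open>The coordinates are in general dependent but always uncorrelated: the cross term of the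
  induction step is odd in the new coordinate.\<close>

lemma expectation_linear_square:
  "n \<le> d \<Longrightarrow> expectation (\<lambda>v. (\<Sum>i<n. w i * v i) ^ 2) = (\<Sum>i<n. (w i)\<^sup>2 * expectation (\<lambda>v. (v i)\<^sup>2))"
proof (induction n)
  case (Suc n)
  let ?S = "\<lambda>v. \<Sum>i<n. w i * v i"
  have n: "n \<le> d" "n < d" using Suc.prems by auto
  note int = integrable_linear_monomial[OF n, of w] integrable_linear_power[OF n(1), of w] integrable_coord_power[OF n(2)]
  have "(\<lambda>v. (\<Sum>i<Suc n. w i * v i) ^ 2)
      = (\<lambda>v. ?S v ^ 2 + 2 * w n * (?S v ^ 1 * v n ^ 1) + (w n)\<^sup>2 * (v n)\<^sup>2)"
    by (simp add: power2_sum power_mult_distrib mult_ac fun_eq_iff)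
  then have "expectation (\<lambda>v. (\<Sum>i<Suc n. w i * v i) ^ 2)
      = expectation (\<lambda>v. ?S v ^ 2) + 2 * w n * expectation (\<lambda>v. ?S v ^ 1 * v n ^ 1)
        + (w n)\<^sup>2 * expectation (\<lambda>v. (v n)\<^sup>2)"
    using int(1)[of 1 1] int(2)[of 2] int(3)[of 2] by simp
  then show ?case
    using Suc.IH n odd_moment_eq_0[of n 1 w 1] by simp
qed simp

text \<open>Adding one coordinate, the odd terms vanish and only the mixed term
  \<open>6 * (w n)^2 * S^2 * (v n)^2\<close> needs an estimate. The factor 9 closes the induction:
  the mixed moment is at most \<open>3 * M * s\<close>, the geometric mean of
  \<open>9 * M * s^2\<close> and \<open>M\<close> times \<open>sqrt s ^ 0\<close>, where
  \<open>s\<close> is the sum of squared weights.\<close>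

lemma expectation_linear_fourth_le:
  defines "M \<equiv> 1536 * exp (5 / 2) / D ^ 4"
  shows "n \<le> d \<Longrightarrow> expectation (\<lambda>v. (\<Sum>i<n. w i * v i) ^ 4) \<le> 9 * M * (\<Sum>i<n. (w i)\<^sup>2)\<^sup>2"
proof (induction n)
  case (Suc n)
  let ?S = "\<lambda>v. \<Sum>i<n. w i * v i"
  let ?s = "\<Sum>i<n. (w i)\<^sup>2"
  have n: "n \<le> d" "n < d" using Suc.prems by auto
  have M: "M \<ge> 0" by (simp add: M_def)
  have vn: "expectation (\<lambda>v. v n ^ 4) \<le> M"
    using fourth_moment_coord_le[OF n(2)] by (simp add: M_def)
  note intSv = integrable_linear_monomial[OF n, of w]
    and intS = integrable_linear_power[OF n(1), of w] and intv = integrable_coord_power[OF n(2)]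
  have cross: "expectation (\<lambda>v. ?S v ^ 2 * v n ^ 2) \<le> 3 * M * ?s"
  \<comment> \<open>The AM-GM weight \<open>1 / (6 * ?s)\<close> below requires a positive sum; if
    it is zero, so is the partial linear form.\<close>
  proof (cases "?s = 0")
    case True
    then have "w i = 0" if "i < n" for i
      using that by (simp add: sum_nonneg_eq_0_iff)
    then show ?thesis by simp
  next
    case False
    moreover have "?s \<ge> 0" by (simp add: sum_nonneg)
    ultimately have s: "?s > 0" by linarith
    have "expectation (\<lambda>v. ?S v ^ 2 * v n ^ 2) \<le> expectation (\<lambda>v. 1 / (6 * ?s) * ?S v ^ 4 + 3 * ?s / 2 * v n ^ 4)"
    proof (rule integral_mono)
      fix v :: "nat \<Rightarrow> real"
      \<comment> \<open>The weight \<open>3 * ?s\<close> balances the two fourth-moment bounds, so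
        that each term contributes \<open>3 / 2 * M * ?s\<close>.\<close>
      have "0 \<le> (?S v ^ 2 - 3 * ?s * v n ^ 2)\<^sup>2" by simp
      then have "6 * ?s * (?S v ^ 2 * v n ^ 2) \<le> ?S v ^ 4 + 9 * ?s ^ 2 * v n ^ 4"
        by (simp add: power2_diff power_mult_distrib mult_ac flip: power_mult)
      then show "?S v ^ 2 * v n ^ 2 \<le> 1 / (6 * ?s) * ?S v ^ 4 + 3 * ?s / 2 * v n ^ 4"
        using s by (simp add: field_simps power2_eq_square)
    qed (auto intro!: Bochner_Integration.integrable_add integrable_mult_right intSv intS intv)
    also have "\<dots> = 1 / (6 * ?s) * expectation (\<lambda>v. ?S v ^ 4) + 3 * ?s / 2 * expectation (\<lambda>v. v n ^ 4)"
      using intS[of 4] intv[of 4] by simp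
    also have "\<dots> \<le> 1 / (6 * ?s) * (9 * M * ?s ^ 2) + 3 * ?s / 2 * M"
      using Suc.IH n vn s by (intro add_mono mult_left_mono) auto
    also have "\<dots> = 3 * M * ?s"
      using s by (simp add: field_simps power2_eq_square)
    finally show ?thesis .
  qed
  have "(\<lambda>v. (\<Sum>i<Suc n. w i * v i) ^ 4)
      = (\<lambda>v. ?S v ^ 4 + 4 * w n * (?S v ^ 3 * v n ^ 1) + 6 * (w n)\<^sup>2 * (?S v ^ 2 * v n ^ 2)
        + 4 * (w n) ^ 3 * (?S v ^ 1 * v n ^ 3) + (w n) ^ 4 * v n ^ 4)"
    by (simp add: fun_eq_iff power_mult_distrib algebra_simps eval_nat_numeral)
  then have "expectation (\<lambda>v. (\<Sum>i<Suc n. w i * v i) ^ 4)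
      = expectation (\<lambda>v. ?S v ^ 4) + 4 * w n * expectation (\<lambda>v. ?S v ^ 3 * v n ^ 1)
        + 6 * (w n)\<^sup>2 * expectation (\<lambda>v. ?S v ^ 2 * v n ^ 2)
        + 4 * (w n) ^ 3 * expectation (\<lambda>v. ?S v ^ 1 * v n ^ 3) + (w n) ^ 4 * expectation (\<lambda>v. v n ^ 4)"
    using intSv[of 3 1] intSv[of 2 2] intSv[of 1 3] intS[of 4] intv[of 4] by simp
  also have "\<dots> = expectation (\<lambda>v. ?S v ^ 4) + 6 * (w n)\<^sup>2 * expectation (\<lambda>v. ?S v ^ 2 * v n ^ 2)
        + (w n) ^ 4 * expectation (\<lambda>v. v n ^ 4)"
    using n odd_moment_eq_0[of n 1 w 3] odd_moment_eq_0[of n 3 w 1] by simp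
  also have "\<dots> \<le> 9 * M * ?s ^ 2 + 6 * (w n)\<^sup>2 * (3 * M * ?s) + (w n) ^ 4 * M"
    using Suc.IH n vn cross by (intro add_mono mult_left_mono) auto
  \<comment> \<open>Enlarging the last coefficient completes the square.\<close>
  also have "\<dots> \<le> 9 * M * ?s ^ 2 + 6 * (w n)\<^sup>2 * (3 * M * ?s) + (w n) ^ 4 * (9 * M)"
    using M by (intro add_left_mono mult_left_mono) auto
  also have "\<dots> = 9 * M * (?s + (w n)\<^sup>2)\<^sup>2"
    by (simp add: algebra_simps eval_nat_numeral)
  finally show ?case by simp
qed simp

section \<open>Upper and lower tail bounds for linear forms\<close>

lemma measurable_linear [measurable]: "(\<lambda>v. \<Sum>i<d. w i * v i) \<in> borel_measurable U"
  using integrable_linear_power[of d w 1] by auto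

text \<open>Chebyshev's inequality with the diagonal second moments. The two-sided event later
  covers scalings \<open>\<alpha>\<close> of either sign.\<close>

lemma prob_linear_ge_le:
  assumes t: "t > 0"
  shows "prob {v \<in> space U. t \<le> \<bar>\<Sum>i<d. w i * v i\<bar>}
    \<le> 1536 * exp (5 / 2) * (\<Sum>i<d. (w i)\<^sup>2) / (D ^ 2 * t ^ 2)"
proof -
  let ?S = "\<lambda>v. \<Sum>i<d. w i * v i"
  let ?A = "{v \<in> space U. t \<le> \<bar>?S v\<bar>}"
  have "?A = {v \<in> space U. t ^ 2 \<le> ?S v ^ 2}"
    using t by (auto simp flip: abs_le_square_iff)
  then have "prob ?A \<le> expectation (\<lambda>v. ?S v ^ 2) / t ^ 2"
    using t integral_Markov_inequality_measure[OF integrable_linear_power[of d w 2], of "{}" "t ^ 2"] by simp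
  also have "\<dots> = 1 / t ^ 2 * (\<Sum>i<d. (w i)\<^sup>2 * expectation (\<lambda>v. (v i)\<^sup>2))"
    by (simp add: expectation_linear_square)
  also have "\<dots> \<le> 1 / t ^ 2 * (\<Sum>i<d. (w i)\<^sup>2 * (1536 * exp (5 / 2) / D ^ 2))"
    by (intro mult_left_mono sum_mono second_moment_coord_le) auto
  also have "\<dots> = 1536 * exp (5 / 2) * (\<Sum>i<d. (w i)\<^sup>2) / (D ^ 2 * t ^ 2)"
    unfolding sum_distrib_right[symmetric] by (simp add: mult_ac)
  finally show ?thesis .
qed

text \<open>A one-sided Paley--Zygmund inequality; the factor 2 comes from the symmetry of the ball.\<close>
lemma prob_linear_ge_ge:
  assumes t: "t > 0" and \<delta>: "\<delta> > 0"
    and le: "t ^ 2 + \<delta> \<le> exp (- 5 / 2) / 256 / D ^ 2 * (\<Sum>i<d. (w i)\<^sup>2)"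
  shows "\<delta> ^ 2 / (2 * (9 * (1536 * exp (5 / 2) / D ^ 4) * (\<Sum>i<d. (w i)\<^sup>2) ^ 2))
    \<le> prob {v \<in> space U. t \<le> (\<Sum>i<d. w i * v i)}"
proof -
  let ?S = "\<lambda>v. \<Sum>i<d. w i * v i"
  \<comment> \<open>The bound on the fourth moment of the linear form.\<close>
  define B where "B = 9 * (1536 * exp (5 / 2) / D ^ 4) * (\<Sum>i<d. (w i)\<^sup>2) ^ 2"
  define A where "A = {v \<in> space U. t \<le> ?S v}"
  define A' where "A' = {v \<in> space U. t \<le> - ?S v}"
  have AA' [measurable]: "A \<in> sets U" "A' \<in> sets U"
    unfolding A_def A'_def by measurable
  have int: "integrable U (indicator A :: _ \<Rightarrow> real)" "integrable U (indicator A' :: _ \<Rightarrow> real)"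
    using AA' by (auto intro!: integrable_real_indicator simp: emeasure_eq_measure)
  have inter: "A \<inter> space U = A" "A' \<inter> space U = A'"
    by (auto simp: A_def A'_def)
  have sym: "prob A' = prob A"
  proof -
    have "expectation (\<lambda>v. indicator A (\<lambda>i\<in>{..<d}. - 1 * v i) :: real) = expectation (indicator A)"
      by (rule expectation_reflect) auto
    moreover have "expectation (\<lambda>v. indicator A (\<lambda>i\<in>{..<d}. - 1 * v i) :: real) = expectation (indicator A')"
      by (intro Bochner_Integration.integral_cong) (auto simp: indicator_def A_def A'_def space_Rd sum_negf)
    ultimately show ?thesis using inter by simp
  qed
  have "(\<Sum>i<d. (w i)\<^sup>2) > 0"
  proof -
    have "0 < exp (- 5 / 2) / 256 / D ^ 2 * (\<Sum>i<d. (w i)\<^sup>2)"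
      using t \<delta> le by (smt (verit) zero_le_power2)
    then show ?thesis using D_pos by (simp add: zero_less_mult_iff zero_less_divide_iff)
  qed
  then have B: "B > 0" using D_pos by (simp add: B_def)
  have "t ^ 2 + \<delta> \<le> (\<Sum>i<d. (w i)\<^sup>2 * (exp (- 5 / 2) / 256 / D ^ 2))"
    using le unfolding sum_distrib_right[symmetric] by (simp add: mult_ac)
  also have "\<dots> \<le> expectation (\<lambda>v. ?S v ^ 2)"
    unfolding expectation_linear_square[OF order_refl] by (intro sum_mono mult_left_mono second_moment_coord_ge) auto
  \<comment> \<open>Off \<open>A\<close> and \<open>A'\<close> the square is at most
    \<open>t ^ 2\<close>; on them AM-GM replaces the Cauchy-Schwarz inequality. The weight is chosen
    so that the fourth-moment term costs at most \<open>\<delta> / 2\<close>, half of the available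
    slack.\<close>
  also have "\<dots> \<le> expectation (\<lambda>v. t ^ 2 + \<delta> / (2 * B) * ?S v ^ 4 + B / (2 * \<delta>) * (indicator A v + indicator A' v))"
  proof (rule integral_mono)
    show "integrable U (\<lambda>v. ?S v ^ 2)" by (simp add: integrable_linear_power)
    show "integrable U (\<lambda>v. t ^ 2 + \<delta> / (2 * B) * ?S v ^ 4 + B / (2 * \<delta>) * (indicator A v + indicator A' v))"
      by (intro Bochner_Integration.integrable_add integrable_mult_right integrable_linear_power int) auto
    fix v assume v: "v \<in> space U"
    have "0 \<le> (\<delta> * ?S v ^ 2 - B)\<^sup>2" by simp
    then have "2 * \<delta> * B * ?S v ^ 2 \<le> \<delta> ^ 2 * ?S v ^ 4 + B ^ 2"
      by (simp add: power2_diff power_mult_distrib mult_ac flip: power_mult)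
    then have AMGM: "?S v ^ 2 \<le> \<delta> / (2 * B) * ?S v ^ 4 + B / (2 * \<delta>)"
      using B \<delta> by (simp add: field_simps power2_eq_square)
    show "?S v ^ 2 \<le> t ^ 2 + \<delta> / (2 * B) * ?S v ^ 4 + B / (2 * \<delta>) * (indicator A v + indicator A' v)"
    proof (cases "v \<in> A \<or> v \<in> A'")
      case True
      then have "1 \<le> (indicator A v + indicator A' v :: real)" by (auto simp: indicator_def)
      then have "B / (2 * \<delta>) * 1 \<le> B / (2 * \<delta>) * (indicator A v + indicator A' v)"
        using B \<delta> by (intro mult_left_mono) auto
      then show ?thesis using AMGM zero_le_power2[of t] by linarith
    next
      case False
      then have "\<bar>?S v\<bar> \<le> \<bar>t\<bar>" using v by (auto simp: A_def A'_def)
      then have "?S v ^ 2 \<le> t ^ 2" by (simp only: abs_le_square_iff)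
      moreover have "0 \<le> \<delta> / (2 * B) * ?S v ^ 4" using B \<delta> by simp
      ultimately show ?thesis using False by simp
    qed
  qed
  also have "\<dots> = t ^ 2 + \<delta> / (2 * B) * expectation (\<lambda>v. ?S v ^ 4) + B / (2 * \<delta>) * (prob A + prob A')"
    using integrable_linear_power[of d w 4] int inter by simp
  also have "\<dots> \<le> t ^ 2 + \<delta> / (2 * B) * B + B / (2 * \<delta>) * (2 * prob A)"
    using expectation_linear_fourth_le[of d w] B \<delta> sym
    by (intro add_mono mult_left_mono) (auto simp: B_def)
  also have "\<dots> = t ^ 2 + \<delta> / 2 + B / \<delta> * prob A"
    using B by simp
  finally have "\<delta> / 2 \<le> B / \<delta> * prob A" by linarith
  then have "\<delta> ^ 2 / (2 * B) \<le> prob A"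
    using B \<delta> by (simp add: field_simps power2_eq_square)
  then show ?thesis by (simp add: A_def B_def)
qed

end

subsection \<open>Linear classifiers\<close>

text \<open>A unique label means strict dominance, so a mere tie already counts as a change of
  label.\<close>

lemma label_set_eq_singleton_iff:
  "label_set W b L d z = {k} \<longleftrightarrow> k < L \<and> (\<forall>l<L. l \<noteq> k \<longrightarrow> lin_f W b d l z < lin_f W b d k z)"
proof
  assume eq: "label_set W b L d z = {k}"
  then have k: "k < L" "\<forall>m<L. lin_f W b d m z \<le> lin_f W b d k z"
    by (auto simp: label_set_def)
  have "lin_f W b d l z < lin_f W b d k z" if l: "l < L" "l \<noteq> k" for l
  proof (rule ccontr)
    assume "\<not> ?thesis"
    then have "l \<in> label_set W b L d z"
      using k l by (fastforce simp: label_set_def)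
    then show False using eq l by auto
  qed
  then show "k < L \<and> (\<forall>l<L. l \<noteq> k \<longrightarrow> lin_f W b d l z < lin_f W b d k z)"
    using k by auto
next
  assume *: "k < L \<and> (\<forall>l<L. l \<noteq> k \<longrightarrow> lin_f W b d l z < lin_f W b d k z)"
  then have "lin_f W b d m z \<le> lin_f W b d k z" if "m < L" for m
    using that by (cases "m = k") (auto simp: less_imp_le)
  moreover have "l = k" if "l \<in> label_set W b L d z" for l
    using that * by (force simp: label_set_def not_le)
  ultimately show "label_set W b L d z = {k}"
    using * by (auto simp: label_set_def)
qed

locale minimal_perturbation = lp_ball_uniform p d for p :: ereal and d :: nat +
  fixes L :: nat and p' :: ereal and W :: "nat \<Rightarrow> nat \<Rightarrow> real" and b x :: "nat \<Rightarrow> real"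
    and k :: nat and r :: "nat \<Rightarrow> real"
  assumes p': "p' \<ge> 1" and conj: "inverse p + inverse p' = 1" and L: "L \<ge> 2"
    and label: "label_set W b L d x = {k}"
    and distinct: "\<And>l. l < L \<Longrightarrow> l \<noteq> k \<Longrightarrow> \<exists>i<d. W l i \<noteq> W k i"
    and min_pert: "is_min_pert W b L d p x r" and r_pos: "lp_norm p d r > 0"
begin

abbreviation "R \<equiv> lp_norm p d r"

definition "gap l = lin_f W b d k x - lin_f W b d l x"

text \<open>The sign is opposite to that in \<open>w_ratio\<close>, so that moving towards class
  \<open>l\<close> makes the linear form positive.\<close>

definition "w l = (\<lambda>i. W l i - W k i)"

lemma lp_norm_w: "lp_norm q d (\<lambda>i. W k i - W l i) = lp_norm q d (w l)"
  by (simp add: lp_norm_def w_def abs_minus_commute)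

lemma k_less: "k < L"
  using label by (simp add: label_set_eq_singleton_iff)

lemma gap_pos: "l < L \<Longrightarrow> l \<noteq> k \<Longrightarrow> gap l > 0"
  using label by (simp add: label_set_eq_singleton_iff gap_def)

lemma lp_norm_w_pos:
  assumes "q \<ge> 1" "l < L" "l \<noteq> k"
  shows "lp_norm q d (w l) > 0"
  using distinct[OF assms(2,3)] lp_norm_eq_0[OF assms(1), of d "w l"] lp_norm_nonneg[of q d "w l"]
  by (force simp: w_def)

lemma sum_w_square: "(\<Sum>i<d. (w l i)\<^sup>2) = (lp_norm 2 d (w l))\<^sup>2"
  unfolding lp_norm_2 by (simp add: sum_nonneg)

lemma lin_f_add: "lin_f W b d l (\<lambda>i. x i + y i) - lin_f W b d k (\<lambda>i. x i + y i) = (\<Sum>i<d. w l i * y i) - gap l"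
  by (simp add: lin_f_def gap_def w_def algebra_simps sum.distrib sum_subtractf)

text \<open>The label-changing perturbations form a finite union of closed half-spaces; they are
  closed because ties count.\<close>

lemma label_changes_iff:
  "label_set W b L d (\<lambda>i. x i + y i) \<noteq> label_set W b L d x \<longleftrightarrow>
    (\<exists>l<L. l \<noteq> k \<and> gap l \<le> (\<Sum>i<d. w l i * y i))"
  unfolding label label_set_eq_singleton_iff using k_less lin_f_add[of _ y]
  by (auto simp: not_less) (smt (verit))+

text \<open>The dual vector of \<open>w l\<close>, scaled to reach the gap, changes the label, so
  minimality bounds \<open>R\<close> by its norm.\<close>

lemma norm_le_gap:
  assumes l: "l < L" "l \<noteq> k"
  shows "R * lp_norm p' d (w l) \<le> gap l"
proof -
  have "\<exists>i<d. w l i \<noteq> 0" using distinct[OF l] by (simp add: w_def)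
  then obtain z where z: "(\<Sum>i<d. w l i * z i) = gap l" "lp_norm p d z \<le> gap l / lp_norm p' d (w l)"
    using lp_norm_dual_vector[OF p p' conj] gap_pos[OF l] by (metis less_imp_le)
  have "label_set W b L d (\<lambda>i. x i + z i) \<noteq> label_set W b L d x"
    unfolding label_changes_iff using l z(1) by auto
  then have "R \<le> lp_norm p d z"
    using min_pert unfolding is_min_pert_def by blast
  then have "R \<le> gap l / lp_norm p' d (w l)"
    using z(2) by (rule order_trans)
  then show ?thesis
    using lp_norm_w_pos[OF p' l] by (simp add: pos_le_divide_eq)
qed

text \<open>At \<open>x + r\<close> class \<open>l\<close> scores at least as high as
  \<open>k\<close>, so the linear form at \<open>r\<close> reaches the gap. Together with
  \<open>norm_le_gap\<close> this determines \<open>R\<close> exactly for a boundary class.\<close>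

lemma gap_le_norm:
  assumes l: "l < L" "l \<noteq> k" and mem: "l \<in> label_set W b L d (\<lambda>i. x i + r i)"
  shows "gap l \<le> lp_norm p' d (w l) * R"
proof -
  have "gap l \<le> (\<Sum>i<d. w l i * r i)"
    using mem k_less lin_f_add[of l r] by (auto simp: label_set_def)
  also have "\<dots> \<le> lp_norm p' d (w l) * R"
    by (rule Holder_inequality[OF p p' conj])
  finally show ?thesis .
qed

section \<open>Flip probabilities and the two bounds on the random radius\<close>

lemma flip_prob_eq:
  "flip_prob W b L d p x \<alpha> = prob {v \<in> space U. \<exists>l<L. l \<noteq> k \<and> gap l \<le> \<alpha> * (\<Sum>i<d. w l i * v i)}"
  unfolding flip_prob_def label_changes_iff
  by (simp add: U_def[symmetric] sum_distrib_left mult_ac)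

text \<open>A union bound over the \<open>L - 1\<close> competing classes. The gap of each is at
  least \<open>\<rho> * R\<close> times the Euclidean norm of \<open>w l\<close>, which makes the
  Chebyshev bounds independent of the class.\<close>

lemma flip_prob_le:
  assumes \<rho>: "\<rho> > 0" "\<And>l. l < L \<Longrightarrow> l \<noteq> k \<Longrightarrow> \<rho> \<le> w_ratio W d p' k l"
    and \<alpha>: "\<alpha> \<noteq> 0"
  shows "flip_prob W b L d p x \<alpha> \<le> (real L - 1) * (1536 * exp (5 / 2) * \<alpha>\<^sup>2 / (D * \<rho> * R)\<^sup>2)"
proof -
  let ?A = "\<lambda>l. {v \<in> space U. gap l / \<bar>\<alpha>\<bar> \<le> \<bar>\<Sum>i<d. w l i * v i\<bar>}"
  have A: "?A l \<in> sets U" for l by measurable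
  have "flip_prob W b L d p x \<alpha> \<le> prob (\<Union>l\<in>{..<L} - {k}. ?A l)"
    unfolding flip_prob_eq
  proof (rule finite_measure_mono)
    show "{v \<in> space U. \<exists>l<L. l \<noteq> k \<and> gap l \<le> \<alpha> * (\<Sum>i<d. w l i * v i)} \<subseteq> (\<Union>l\<in>{..<L} - {k}. ?A l)"
    proof safe
      fix v l assume v: "v \<in> space U" and l: "l < L" "l \<noteq> k" and le: "gap l \<le> \<alpha> * (\<Sum>i<d. w l i * v i)"
      have "gap l \<le> \<bar>\<alpha>\<bar> * \<bar>\<Sum>i<d. w l i * v i\<bar>"
        using le abs_ge_self[of "\<alpha> * (\<Sum>i<d. w l i * v i)"] by (simp add: abs_mult)
      then have "gap l / \<bar>\<alpha>\<bar> \<le> \<bar>\<Sum>i<d. w l i * v i\<bar>" using \<alpha> by (simp add: pos_divide_le_eq mult.commute)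
      then show "v \<in> (\<Union>l\<in>{..<L} - {k}. ?A l)" using v l by blast
    qed
  qed (use A in blast)
  also have "\<dots> \<le> (\<Sum>l\<in>{..<L} - {k}. prob (?A l))"
    using A by (intro finite_measure_subadditive_finite) auto
  also have "\<dots> \<le> (\<Sum>l\<in>{..<L} - {k}. 1536 * exp (5 / 2) * \<alpha>\<^sup>2 / (D * \<rho> * R)\<^sup>2)"
  proof (rule sum_mono)
    fix l assume "l \<in> {..<L} - {k}"
    then have l: "l < L" "l \<noteq> k" by auto
    define E where "E = lp_norm 2 d (w l)"
    have E: "E > 0" unfolding E_def using l by (intro lp_norm_w_pos) simp_all
    have "prob (?A l) \<le> 1536 * exp (5 / 2) * E\<^sup>2 / (D\<^sup>2 * (gap l / \<bar>\<alpha>\<bar>)\<^sup>2)"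
      using prob_linear_ge_le[of "gap l / \<bar>\<alpha>\<bar>" "w l"] gap_pos[OF l] \<alpha> by (simp add: sum_w_square E_def)
    also have "\<dots> = 1536 * exp (5 / 2) * \<alpha>\<^sup>2 / (D * (gap l / E))\<^sup>2"
      using E by (simp add: power_divide power_mult_distrib)
    also have "\<dots> \<le> 1536 * exp (5 / 2) * \<alpha>\<^sup>2 / (D * \<rho> * R)\<^sup>2"
    proof (intro divide_left_mono power_mono)
      have "\<rho> * E \<le> lp_norm p' d (w l)"
        using \<rho>(2)[OF l] E unfolding w_ratio_def lp_norm_w E_def[symmetric]
        by (simp add: pos_le_divide_eq)
      then have "R * (\<rho> * E) \<le> R * lp_norm p' d (w l)"
        using r_pos by (intro mult_left_mono) auto
      then have "\<rho> * R \<le> gap l / E"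
        using norm_le_gap[OF l] E by (simp add: field_simps)
      then show "D * \<rho> * R \<le> D * (gap l / E)"
        using mult_left_mono[of "\<rho> * R" "gap l / E" D] D_pos by (simp only: mult.assoc)
    qed (use D_pos E \<rho>(1) r_pos gap_pos[OF l] in auto)
    finally show "prob (?A l) \<le> 1536 * exp (5 / 2) * \<alpha>\<^sup>2 / (D * \<rho> * R)\<^sup>2" .
  qed
  also have "\<dots> = (real L - 1) * (1536 * exp (5 / 2) * \<alpha>\<^sup>2 / (D * \<rho> * R)\<^sup>2)"
    using k_less L by (simp add: of_nat_diff)
  finally show ?thesis .
qed

text \<open>The bound on the flip probability is solved for \<open>\<bar>\<alpha>\<bar>\<close>; the
  minimising class supplies the uniform \<open>\<rho>\<close>.\<close>

lemma r_eps_ge: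
  assumes j: "j < L" "j \<noteq> k" and min: "\<And>l. l < L \<Longrightarrow> l \<noteq> k \<Longrightarrow> w_ratio W d p' k j \<le> w_ratio W d p' k l"
    and \<epsilon>: "\<epsilon> > 0"
  shows "ereal (1 / sqrt (1536 * exp (5 / 2)) * sqrt (\<epsilon> / (real L - 1)) * D * w_ratio W d p' k j)
    \<le> r_eps W b L d p x \<epsilon> / ereal R"
proof -
  define \<rho> where "\<rho> = w_ratio W d p' k j"
  define M :: real where "M = 1536 * exp (5 / 2)"
  have M: "M > 0" by (simp add: M_def)
  have \<rho>: "\<rho> > 0"
    unfolding \<rho>_def w_ratio_def lp_norm_w using j p' by (intro divide_pos_pos lp_norm_w_pos) simp_all
  have L1: "real L - 1 > 0" using L by simp
  have "1 / sqrt M * sqrt (\<epsilon> / (real L - 1)) * D * \<rho> * R \<le> \<bar>\<alpha>\<bar>"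
    if prob: "\<epsilon> \<le> flip_prob W b L d p x \<alpha>" for \<alpha>
  proof -
    have "\<alpha> \<noteq> 0"
    proof
      assume "\<alpha> = 0"
      then have "{v \<in> space U. \<exists>l<L. l \<noteq> k \<and> gap l \<le> \<alpha> * (\<Sum>i<d. w l i * v i)} = {}"
        using gap_pos by force
      then have "flip_prob W b L d p x \<alpha> = 0" by (simp only: flip_prob_eq measure_empty)
      then show False using prob \<epsilon> by simp
    qed
    then have "\<epsilon> \<le> (real L - 1) * (M * \<alpha>\<^sup>2 / (D * \<rho> * R)\<^sup>2)"
      using prob flip_prob_le[OF \<rho> _ \<open>\<alpha> \<noteq> 0\<close>] min unfolding M_def \<rho>_def by (meson order_trans)
    then have "\<epsilon> / (real L - 1) / M * (D * \<rho> * R)\<^sup>2 \<le> \<alpha>\<^sup>2"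
      using L1 M D_pos \<rho> r_pos by (simp add: field_simps)
    moreover have "(1 / sqrt M * sqrt (\<epsilon> / (real L - 1)) * D * \<rho> * R)\<^sup>2 = \<epsilon> / (real L - 1) / M * (D * \<rho> * R)\<^sup>2"
      using M \<epsilon> L1 by (simp add: power_mult_distrib power_divide)
    ultimately have "(1 / sqrt M * sqrt (\<epsilon> / (real L - 1)) * D * \<rho> * R)\<^sup>2 \<le> \<bar>\<alpha>\<bar>\<^sup>2"
      by (simp only: power2_abs)
    then show ?thesis
      by (rule power2_le_imp_le) simp
  qed
  \<comment> \<open>If no \<open>\<alpha>\<close> is admissible, the infimum is infinite and the
    bound still holds.\<close>
  then have "ereal (1 / sqrt M * sqrt (\<epsilon> / (real L - 1)) * D * \<rho> * R) \<le> r_eps W b L d p x \<epsilon>"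
    unfolding r_eps_def by (intro Inf_greatest) auto
  then show ?thesis
    using r_pos by (subst ereal_le_divide_pos) (auto simp: M_def \<rho>_def mult_ac)
qed

text \<open>It suffices to exhibit one scaling at which crossing towards class \<open>j\<close>
  alone has probability at least \<open>\<epsilon>\<close>.\<close>

lemma r_eps_le:
  assumes j: "j < L" "j \<noteq> k" and mem: "j \<in> label_set W b L d (\<lambda>i. x i + r i)"
    and \<epsilon>: "\<epsilon> > 0"
  defines "c \<equiv> exp (- 5 / 2) / 256" and "M \<equiv> 1536 * exp (5 / 2)"
  assumes \<epsilon>_less: "sqrt (18 * M * \<epsilon>) < c"
  shows "r_eps W b L d p x \<epsilon> / ereal R
    \<le> ereal (1 / sqrt (c - sqrt (18 * M * \<epsilon>)) * D * w_ratio W d p' k j)"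
proof -
  define E where "E = lp_norm 2 d (w j)"
  define N where "N = lp_norm p' d (w j)"
  have pos: "E > 0" "N > 0"
    unfolding E_def N_def using j p' by (auto intro!: lp_norm_w_pos)
  have M: "M > 0" by (simp add: M_def)
  define \<tau> where "\<tau> = sqrt (c - sqrt (18 * M * \<epsilon>))"
  have \<tau>: "\<tau> > 0" "\<tau>\<^sup>2 = c - sqrt (18 * M * \<epsilon>)"
    using \<epsilon>_less by (simp_all add: \<tau>_def)
  \<comment> \<open>The claimed upper bound multiplied by \<open>R\<close>; it brings the threshold
    \<open>t\<close> down to at most \<open>\<tau> * E / D\<close>.\<close>
  define \<alpha> where "\<alpha> = 1 / \<tau> * D * (N / E) * R"
  have \<alpha>: "\<alpha> > 0"
    using \<tau> D_pos pos r_pos by (simp add: \<alpha>_def)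
  define t where "t = gap j / \<alpha>"
  \<comment> \<open>The slack left by \<open>t ^ 2\<close> below \<open>c * E ^ 2 / D ^ 2\<close>.
    With it the Paley-Zygmund bound equals \<open>\<epsilon>\<close> exactly, which is where
    \<open>18 = 2 * 9\<close> comes from.\<close>
  define \<delta> where "\<delta> = sqrt (18 * M * \<epsilon>) * E\<^sup>2 / D\<^sup>2"
  have t: "t > 0" using gap_pos[OF j] \<alpha> by (simp add: t_def)
  have \<delta>: "\<delta> > 0" using M \<epsilon> pos D_pos by (simp add: \<delta>_def)
  have "t \<le> N * R / \<alpha>"
    unfolding t_def N_def using \<alpha> gap_le_norm[OF j mem] by (intro divide_right_mono) auto
  also have "\<dots> = \<tau> * E / D"
    using \<tau> D_pos pos r_pos by (simp add: \<alpha>_def field_simps)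
  finally have "t\<^sup>2 \<le> (\<tau> * E / D)\<^sup>2"
    using t by (intro power_mono) auto
  also have "\<dots> = (c - sqrt (18 * M * \<epsilon>)) * E\<^sup>2 / D\<^sup>2"
    by (simp add: power_mult_distrib power_divide \<tau>(2))
  finally have "t\<^sup>2 + \<delta> \<le> c / D\<^sup>2 * E\<^sup>2"
    by (simp add: \<delta>_def left_diff_distrib diff_divide_distrib)
  then have "\<delta>\<^sup>2 / (2 * (9 * (M / D ^ 4) * (E\<^sup>2)\<^sup>2)) \<le> prob {v \<in> space U. t \<le> (\<Sum>i<d. w j i * v i)}"
    using prob_linear_ge_ge[OF t \<delta>, of "w j"] by (simp add: sum_w_square E_def c_def M_def)
  moreover have "\<delta>\<^sup>2 / (2 * (9 * (M / D ^ 4) * (E\<^sup>2)\<^sup>2)) = \<epsilon>"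
    using M \<epsilon> pos D_pos by (simp add: \<delta>_def power_mult_distrib power_divide flip: power_mult)
  moreover have "prob {v \<in> space U. t \<le> (\<Sum>i<d. w j i * v i)} \<le> flip_prob W b L d p x \<alpha>"
    unfolding flip_prob_eq
  proof (rule finite_measure_mono)
    show "{v \<in> space U. t \<le> (\<Sum>i<d. w j i * v i)}
        \<subseteq> {v \<in> space U. \<exists>l<L. l \<noteq> k \<and> gap l \<le> \<alpha> * (\<Sum>i<d. w l i * v i)}"
      using j \<alpha> by (auto simp: t_def field_simps)
  qed measurable
  ultimately have "\<epsilon> \<le> flip_prob W b L d p x \<alpha>" by simp
  then have "r_eps W b L d p x \<epsilon> \<le> ereal \<bar>\<alpha>\<bar>"
    unfolding r_eps_def by (intro Inf_lower) auto
  then have "r_eps W b L d p x \<epsilon> \<le> ereal \<alpha>"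
    using \<alpha> by simp
  then have "r_eps W b L d p x \<epsilon> / ereal R \<le> ereal (1 / \<tau> * D * (N / E))"
    using r_pos by (subst ereal_divide_le_pos) (auto simp: \<alpha>_def mult_ac)
  then show ?thesis
    by (simp add: \<tau>_def N_def E_def w_ratio_def lp_norm_w)
qed

end

theorem theorem5:
  shows "\<exists>C c c' :: real. C > 0 \<and> c > 0 \<and> c' > 0 \<and>
    (\<forall>(d::nat) (L::nat) (p::ereal) (p'::ereal) (W::nat \<Rightarrow> nat \<Rightarrow> real) (b::nat \<Rightarrow> real)
       (x::nat \<Rightarrow> real) (k::nat) (r::nat \<Rightarrow> real) (j::nat) (j'::nat) (\<epsilon>::real).
      d \<ge> 1 \<longrightarrow> L \<ge> 2 \<longrightarrow> p \<ge> 1 \<longrightarrow> p' \<ge> 1 \<longrightarrow> inverse p + inverse p' = 1 \<longrightarrow>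
      label_set W b L d x = {k} \<longrightarrow>
      (\<forall>l<L. l \<noteq> k \<longrightarrow> (\<exists>i<d. W l i \<noteq> W k i)) \<longrightarrow>
      is_min_pert W b L d p x r \<longrightarrow> lp_norm p d r > 0 \<longrightarrow>
      j < L \<longrightarrow> j \<noteq> k \<longrightarrow> {k, j} \<subseteq> label_set W b L d (\<lambda>i. x i + r i) \<longrightarrow>
      j' < L \<longrightarrow> j' \<noteq> k \<longrightarrow> (\<forall>l<L. l \<noteq> k \<longrightarrow> w_ratio W d p' k j' \<le> w_ratio W d p' k l) \<longrightarrow>
      0 < \<epsilon> \<longrightarrow> \<epsilon> < c\<^sup>2 / c' \<longrightarrow>
        ereal (C * sqrt (\<epsilon> / (real L - 1)) * d_pow p d * w_ratio W d p' k j')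
          \<le> r_eps W b L d p x \<epsilon> / ereal (lp_norm p d r) \<and>
        r_eps W b L d p x \<epsilon> / ereal (lp_norm p d r)
          \<le> ereal (1 / sqrt (c - sqrt (c' * \<epsilon>)) * d_pow p d * w_ratio W d p' k j))"
proof (intro exI conjI allI impI)
  \<comment> \<open>Here \<open>?c\<close> and \<open>?M\<close> are the lower second-moment and
    upper fourth-moment constants of the coordinates; the factor 18 combines the symmetry factor 2
    with the 9 of the fourth-moment bound.\<close>
  let ?c = "exp (- 5 / 2) / 256 :: real" and ?M = "1536 * exp (5 / 2) :: real"
  show "0 < 1 / sqrt ?M" "0 < ?c" "0 < 18 * ?M" by simp_all
  fix d L p p' W b x k r j j' and \<epsilon> :: real
  assume "d \<ge> 1" "L \<ge> 2" "p \<ge> 1" "p' \<ge> 1" "inverse p + inverse p' = 1"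
    "label_set W b L d x = {k}" "\<forall>l<L. l \<noteq> k \<longrightarrow> (\<exists>i<d. W l i \<noteq> W k i)"
    "is_min_pert W b L d p x r" "lp_norm p d r > 0"
    and j: "j < L" "j \<noteq> k" "{k, j} \<subseteq> label_set W b L d (\<lambda>i. x i + r i)"
    and j': "j' < L" "j' \<noteq> k" "\<forall>l<L. l \<noteq> k \<longrightarrow> w_ratio W d p' k j' \<le> w_ratio W d p' k l"
    and \<epsilon>: "0 < \<epsilon>" "\<epsilon> < ?c\<^sup>2 / (18 * ?M)"
  then interpret minimal_perturbation p d L p' W b x k r
    by unfold_locales auto
  show "ereal (1 / sqrt ?M * sqrt (\<epsilon> / (real L - 1)) * d_pow p d * w_ratio W d p' k j')
      \<le> r_eps W b L d p x \<epsilon> / ereal (lp_norm p d r)"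
    using r_eps_ge j' \<epsilon>(1) by blast
  \<comment> \<open>The restriction on \<open>\<epsilon>\<close> says precisely that the quantity
    under the outer root is positive.\<close>
  have "18 * ?M * \<epsilon> < ?c\<^sup>2"
    using \<epsilon>(2) by (simp add: pos_less_divide_eq mult.commute)
  then have "sqrt (18 * ?M * \<epsilon>) < ?c"
    by (intro real_less_lsqrt) auto
  then show "r_eps W b L d p x \<epsilon> / ereal (lp_norm p d r)
      \<le> ereal (1 / sqrt (?c - sqrt (18 * ?M * \<epsilon>)) * d_pow p d * w_ratio W d p' k j)"
    using r_eps_le j \<epsilon>(1) by blast
qed

end
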